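(* Let $P(\lambda)=\sum_{i=0}^kP_i\,\phi_i^{(r)}(\lambda)$, where $r\in\{1,2\}$ and $P_i\in\mathbb{C}^{m\times n}$, be an $m\times n$ matrix polynomial expressed in a Chebyshev basis. Let $0\le\epsilon\le k-1$ be an integer, and let $A$ and $B$ be two arbitrary complex matrices of sizes $(k-\epsilon)m\times\epsilon n$ and $(k-1-\epsilon)m\times(\epsilon+1)n$, respectively. (a) If $r=1$, then the pencil $$C(\lambda)=\begin{bmatrix}M_\epsilon^C(\lambda)+AK_1^{(C,1)}(\lambda)+K_2^{(C,2)}(\lambda)^TB&K_2^{(C,2)}(\lambda)^T\\ K_1^{(C,1)}(\lambda)&0\end{bmatrix}$$ is a strong linearization of $P(\lambda)$ (considered with grade $k$). (b) If $r=2$, then the pencil $$C(\lambda)=\begin{bmatrix}M_\epsilon^C(\lambda)+AK_1^{(C,2)}(\lambda)+K_2^{(C,2)}(\lambda)^TB&K_2^{(C,2)}(\lambda)^T\\ K_1^{(C,2)}(\lambda)&0\end{bmatrix}$$ is a strong linearization of $P(\lambda)$ (considered with grade $k$).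
   Context: Chebyshev setting, $k\ge2$, $m,n\ge1$. $\phi_j^{(1)}$ and $\phi_j^{(2)}$ are the Chebyshev polynomials of the first and second kind: both satisfy $\phi_j(\lambda)=2\lambda\phi_{j-1}(\lambda)-\phi_{j-2}(\lambda)$ for $j\ge2$, with $\phi_0^{(1)}=\phi_0^{(2)}=1$, $\phi_1^{(1)}=\lambda$, $\phi_1^{(2)}=2\lambda$. For $0\le\epsilon\le k-1$ and $i,j\in\{1,2\}$, $K_1^{(C,i)}(\lambda)$ is the $\epsilon\times(\epsilon+1)$ block matrix with blocks of size $n\times n$ $$\begin{bmatrix}I&-2\lambda I&I\\&\ddots&\ddots&\ddots\\&&I&-2\lambda I&I\\&&&I&-\phi_1^{(i)}(\lambda)I\end{bmatrix},$$ and $K_2^{(C,j)}(\lambda)$ is the $(k-1-\epsilon)\times(k-\epsilon)$ block matrix of the same form with blocks of size $m\times m$ and last entry $-\phi_1^{(j)}(\lambda)I_m$ (each block row but the last is $I,-2\lambda I,I$ starting on the diagonal; the last one is $I,-\phi_1I$). $K_1$ is empty if $\epsilon=0$, $K_2$ is empty if $\epsilon=k-1$. $M_\epsilon^C(\lambda)$ is the following $(k-\epsilon)\times(\epsilon+1)$ block pencil with $m\times n$ blocks. • If $1\le\epsilon\le k-2$: the first block column has entries, from top to bottom, $2\lambda P_k+P_{k-1},\ P_{k-2}-P_k,\ P_{k-3},\ldots,P_\epsilon$ (row 1: $2\lambda P_k+P_{k-1}$; row 2: $P_{k-2}-P_k$; row $t\ge3$: $P_{k-t}$); the second block column has entry $-P_{k+1-t}$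 in row $t$ for $1\le t\le k-\epsilon-1$ and entry $P_{\epsilon-1}-P_{\epsilon+1}$ in the last row $k-\epsilon$; the remaining block columns $3,\ldots,\epsilon+1$ are zero except in the last row, whose entries there are $P_{\epsilon-2},P_{\epsilon-3},\ldots,P_0$. • If $\epsilon=k-1$: $M_\epsilon^C=[2\lambda P_k+P_{k-1},\ P_{k-2}-P_k,\ P_{k-3},\ldots,P_1,P_0]$ (block row). • If $\epsilon=0$ and $r=1$: $M_\epsilon^C$ is $\frac12$ times the block column with blocks $2\lambda P_k+P_{k-1},\ P_{k-2}-2P_k,\ P_{k-3}-P_{k-1},\ldots,P_1-P_3,\ 2P_0-P_2$ (for $k=2$: $\frac12$ times the block column with blocks $2\lambda P_2+P_1$, $2P_0-2P_2$). • If $\epsilon=0$ and $r=2$: $M_\epsilon^C$ is the block column with blocks $2\lambda P_k+P_{k-1},\ P_{k-2}-P_k,\ P_{k-3},\ldots,P_1,P_0$. Linearizations. For a matrix polynomial $Q$ of grade $g$ (i.e. written $\sum_{i=0}^gQ_i\lambda^i$, $Q_g$ possibly zero), $\mathrm{rev}_gQ(\lambda)=\lambda^gQ(1/\lambda)$. A pencil is a matrix polynomial of grade 1. A matrix polynomial is unimodular if it is square with nonzero constant determinant. A pencil $L(\lambda)$ is a linearization of $P(\lambda)$ if $U(\lambda)L(\lambda)V(\lambda)=\mathrm{diag}(I_s,P(\lambda))$ for some positive integer $s$ and unimodular $U,V$. It is a strong linearization of the grade-$k$ polynomial $P$ if moreover $\mathrm{rev}_1L$ is a linearization of $\mathrm{rev}_kP$.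 *)

theory Defs
  imports Complex_Main "HOL-Computational_Algebra.Polynomial" "Jordan_Normal_Form.Determinant"
begin

text \<open>Matrix polynomials are matrices over \<^typ>\<open>complex poly\<close>; \<open>[:0, 1:]\<close> is the
  indeterminate \<open>\<lambda>\<close>.\<close>

definition has_grade :: "nat \<Rightarrow> complex poly mat \<Rightarrow> bool" where
  "has_grade g Q \<longleftrightarrow> (\<forall>i < dim_row Q. \<forall>j < dim_col Q. degree (Q $$ (i, j)) \<le> g)"

abbreviation pencil :: "complex poly mat \<Rightarrow> bool" where
  "pencil \<equiv> has_grade 1"

definition rev_poly :: "nat \<Rightarrow> complex poly \<Rightarrow> complex poly" where
  "rev_poly g p = (\<Sum>i\<le>g. monom (coeff p i) (g - i))"

definition rev_mat :: "nat \<Rightarrow> complex poly mat \<Rightarrow> complex poly mat" where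
  "rev_mat g Q = map_mat (rev_poly g) Q"

text \<open>\<^const>\<open>rev_poly\<close> is \<open>\<lambda>\<^sup>g p(1/\<lambda>)\<close>, read as a polynomial:\<close>

lemma poly_rev_poly:
  assumes "degree p \<le> g" and "x \<noteq> 0"
  shows "poly (rev_poly g p) x = x ^ g * poly p (1 / x)"
proof -
  have "poly p (1 / x) = (\<Sum>i\<le>g. coeff p i * (1 / x) ^ i)"
    unfolding poly_altdef
    by (rule sum.mono_neutral_left) (use assms(1) in \<open>auto simp: coeff_eq_0\<close>)
  also have "x ^ g * \<dots> = (\<Sum>i\<le>g. coeff p i * x ^ (g - i))"
    unfolding sum_distrib_left
    by (rule sum.cong) (use assms(2) in \<open>simp_all add: power_diff power_one_over field_simps\<close>)
  finally show ?thesis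
    by (simp add: rev_poly_def poly_sum poly_monom)
qed

definition unimodular :: "complex poly mat \<Rightarrow> bool" where
  "unimodular U \<longleftrightarrow> square_mat U \<and> (\<exists>c. c \<noteq> 0 \<and> det U = [:c:])"

text \<open>The product of \<^typ>\<open>'a mat\<close> is total, so the sizes of \<open>U\<close> and \<open>V\<close> have to be fixed
  explicitly; the size of \<open>L\<close> is then forced by the equation.\<close>

definition linearization :: "complex poly mat \<Rightarrow> complex poly mat \<Rightarrow> bool" where
  "linearization L Q \<longleftrightarrow> pencil L \<and>
    (\<exists>s U V. s > 0 \<and> unimodular U \<and> unimodular V \<and>
      dim_col U = dim_row L \<and> dim_row V = dim_col L \<and>
      U * L * V = diag_block_mat [1\<^sub>m s, Q])"

definition strong_linearization :: "nat \<Rightarrow> complex poly mat \<Rightarrow> complex poly mat \<Rightarrow> bool" where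
  "strong_linearization g L Q \<longleftrightarrow> has_grade g Q \<and>
    linearization L Q \<and> linearization (rev_mat 1 L) (rev_mat g Q)"

datatype cheb_kind = First | Second

fun cheb :: "cheb_kind \<Rightarrow> nat \<Rightarrow> complex poly" where
  "cheb r 0 = 1"
| "cheb r (Suc 0) = (case r of First \<Rightarrow> [:0, 1:] | Second \<Rightarrow> [:0, 2:])"
| "cheb r (Suc (Suc j)) = [:0, 2:] * cheb r (Suc j) - cheb r j"

definition const_mat :: "complex mat \<Rightarrow> complex poly mat" where
  "const_mat X = map_mat (\<lambda>a. [:a:]) X"

definition cheb_mat_poly ::
    "cheb_kind \<Rightarrow> nat \<Rightarrow> nat \<Rightarrow> nat \<Rightarrow> (nat \<Rightarrow> complex mat) \<Rightarrow> complex poly mat" where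
  "cheb_mat_poly r k m n P = mat m n (\<lambda>(i, j). \<Sum>l\<le>k. smult (P l $$ (i, j)) (cheb r l))"

text \<open>The \<open>p \<times> q\<close> block matrix with blocks of size \<open>a \<times> b\<close>. The block in position \<open>(t, c)\<close>
  is \<open>F t c\<close>, where \<open>t\<close> and \<open>c\<close> count from 1 (the entries of a \<^typ>\<open>'a mat\<close> count from 0).\<close>

definition block_mat :: "nat \<Rightarrow> nat \<Rightarrow> nat \<Rightarrow> nat \<Rightarrow> (nat \<Rightarrow> nat \<Rightarrow> 'a mat) \<Rightarrow> 'a mat" where
  "block_mat p q a b F =
    mat (p * a) (q * b) (\<lambda>(i, j). F (i div a + 1) (j div b + 1) $$ (i mod a, j mod b))"

text \<open>The \<open>e \<times> (e + 1)\<close> block matrix with last entry \<open>- \<phi>\<^sub>1 I\<^sub>n\<close>. With \<open>e = \<epsilon>\<close> it is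
  \<open>K\<^sub>1\<close>; with \<open>e = k - 1 - \<epsilon>\<close>, and \<open>m\<close> in place of \<open>n\<close>, it is \<open>K\<^sub>2\<close>.\<close>

definition cheb_K :: "cheb_kind \<Rightarrow> nat \<Rightarrow> nat \<Rightarrow> complex poly mat" where
  "cheb_K i e n = block_mat e (e + 1) n n (\<lambda>t c.
    if c = t then 1\<^sub>m n
    else if c = t + 1 then (if t = e then - (cheb i 1 \<cdot>\<^sub>m 1\<^sub>m n) else - ([:0, 2:] \<cdot>\<^sub>m 1\<^sub>m n))
    else if c = t + 2 then 1\<^sub>m n
    else 0\<^sub>m n n)"

text \<open>The cases are those of the mathematical definition; as \<open>k \<ge> 2\<close>, they do not overlap, and
  no subtraction that is reached truncates.\<close>

definition cheb_M ::
    "cheb_kind \<Rightarrow> nat \<Rightarrow> nat \<Rightarrow> nat \<Rightarrow> nat \<Rightarrow> (nat \<Rightarrow> complex mat) \<Rightarrow> complex poly mat" where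
  "cheb_M r k m n e P =
    (let Q = (\<lambda>i. const_mat (P i)); top = [:0, 2:] \<cdot>\<^sub>m Q k + Q (k - 1) in
     if 1 \<le> e \<and> e \<le> k - 2 then
       block_mat (k - e) (e + 1) m n (\<lambda>t c.
         if c = 1 then
           (if t = 1 then top
            else if t = 2 then Q (k - 2) - Q k
            else Q (k - t))
         else if c = 2 then
           (if t \<le> k - e - 1 then - Q (k + 1 - t)
            else Q (e - 1) - Q (e + 1))
         else
           (if t = k - e then Q (e + 1 - c) else 0\<^sub>m m n))
     else if e = k - 1 then
       block_mat 1 k m n (\<lambda>t c.
         if c = 1 then top
         else if c = 2 then Q (k - 2) - Q k
         else Q (k - c))
     else
       (case r of
          First \<Rightarrow>
            [:1/2:] \<cdot>\<^sub>m block_mat k 1 m n (\<lambda>t c.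
              if t = 1 then top
              else if k = 2 then 2 \<cdot>\<^sub>m Q 0 - 2 \<cdot>\<^sub>m Q 2
              else if t = 2 then Q (k - 2) - 2 \<cdot>\<^sub>m Q k
              else if t = k then 2 \<cdot>\<^sub>m Q 0 - Q 2
              else Q (k - t) - Q (k + 2 - t))
        | Second \<Rightarrow>
            block_mat k 1 m n (\<lambda>t c.
              if t = 1 then top
              else if t = 2 then Q (k - 2) - Q k
              else Q (k - t))))"

end

theory Submission
  imports Defs
begin

text \<open>A pencil \<open>X + \<lambda> Y\<close> is homogenised to \<open>a X + b Y\<close>: the point \<open>(a, b) = (1, \<lambda>)\<close> gives back the
  pencil and \<open>(\<lambda>, 1)\<close> its reversal, so one argument serves both halves of strong linearization.
  The homogenised \<open>K\<close> annihilates the column \<open>N\<close> with entries \<open>a\<^sup>t h\<^bsub>e - t\<^esub>\<close>, where \<open>h\<^sub>j\<close> is the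
  homogenised Chebyshev polynomial. Modulo \<open>a\<close>, \<open>h\<^sub>e\<close> and the last \<open>e n\<close> columns of \<open>K\<close> are invertible,
  while the first \<open>e n\<close> columns of \<open>K\<close> have determinant \<open>a\<^bsup>e n\<^esup>\<close>; by Bezout, \<open>K\<close> has a right and \<open>N\<close> a
  left inverse. Hence \<open>K\<^sub>1\<close> and \<open>K\<^sub>2\<close> extend to unimodular matrices, and eliminating with these reduces
  the pencil to \<open>diag(I, N\<^sub>2\<^sup>T M N\<^sub>1)\<close>. The addition theorem
  \<open>h\<^bsub>p + q + 2\<^esub> = u\<^bsub>p + 1\<^esub> h\<^bsub>q + 1\<^esub> - a\<^sup>2 u\<^sub>p h\<^sub>q\<close>, with \<open>u\<close> of the second kind, identifies \<open>N\<^sub>2\<^sup>T M N\<^sub>1\<close>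
  with \<open>P\<close>.\<close>

section \<open>Linearizations from unimodular completions\<close>

text \<open>The adjugate of \<open>A\<close> equals \<open>det A\<close> times \<open>B\<close>.
  Multiplying this by \<open>A\<close> on the right gives the claim up to the factor
  \<open>det A\<close>, which is a unit and is cancelled by \<open>det B\<close>.\<close>

lemma mat_left_inverse_of_right_inverse:
  fixes A B :: "'a :: idom mat"
  assumes A: "A \<in> carrier_mat n n" and B: "B \<in> carrier_mat n n" and AB: "A * B = 1\<^sub>m n"
  shows "B * A = 1\<^sub>m n"
proof -
  note adj = adj_mat[OF A]
  have d: "det A * det B = 1" using det_mult[OF A B] AB by simp
  have "adj_mat A = (adj_mat A * A) * B"
    using assoc_mult_mat[OF adj(1) A B] AB adj(1) by simp
  also have "\<dots> = det A \<cdot>\<^sub>m B" using adj(3) B by auto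
  finally have "adj_mat A * A = (det A \<cdot>\<^sub>m B) * A" by simp
  hence "det A \<cdot>\<^sub>m (B * A) = det A \<cdot>\<^sub>m 1\<^sub>m n" using adj(3) mult_smult_assoc_mat[OF B A] by simp
  hence "det B \<cdot>\<^sub>m (det A \<cdot>\<^sub>m (B * A)) = det B \<cdot>\<^sub>m (det A \<cdot>\<^sub>m 1\<^sub>m n)" by simp
  moreover have "det B \<cdot>\<^sub>m (det A \<cdot>\<^sub>m E) = E" for E
    using d by (intro eq_matI) (auto simp: mult.assoc[symmetric] mult.commute[of "det B"])
  ultimately show ?thesis by simp
qed

lemma add_uminus_mat:
  "A \<in> carrier_mat r c \<Longrightarrow> A + - (A :: 'a :: ab_group_add mat) = 0\<^sub>m r c"
  by (intro eq_matI) auto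

lemma uminus_zero_mat [simp]: "- (0\<^sub>m r c :: 'a :: group_add mat) = 0\<^sub>m r c"
  by (intro eq_matI) auto

lemma minus_zero_mat:
  "A \<in> carrier_mat r c \<Longrightarrow> A - 0\<^sub>m r c = (A :: 'a :: group_add mat)"
  by (intro eq_matI) auto

text \<open>The two determinants have product 1, and the units among the complex polynomials are the
  nonzero constants. An explicit inverse thus certifies unimodularity without a determinant being
  computed.\<close>

lemma unimodular_if_right_inverse:
  assumes U: "U \<in> carrier_mat n n" and U': "U' \<in> carrier_mat n n" and eq: "U * U' = 1\<^sub>m n"
  shows "unimodular U" "unimodular U'"
proof -
  have d: "det U * det U' = 1" using det_mult[OF U U'] eq by simp
  have const: "\<exists>c. c \<noteq> 0 \<and> p = [:c:]" if "p * q = 1" for p q :: "complex poly"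
    using dvdI[of 1 p q] that by (auto simp: is_unit_poly_iff)
  show "unimodular U" "unimodular U'"
    using U U' const[OF d] const[of "det U'" "det U"] d
    by (auto simp: unimodular_def mult.commute)
qed

section \<open>Concatenation of matrices, as four-block matrices with empty blocks\<close>

definition hcat :: "'a :: zero mat \<Rightarrow> 'a mat \<Rightarrow> 'a mat" where
  "hcat A B = four_block_mat A B (0\<^sub>m 0 (dim_col A)) (0\<^sub>m 0 (dim_col B))"

definition vcat :: "'a :: zero mat \<Rightarrow> 'a mat \<Rightarrow> 'a mat" where
  "vcat A B = four_block_mat A (0\<^sub>m (dim_row A) 0) B (0\<^sub>m (dim_row B) 0)"

lemma hcat_carrier [simp]:
  "A \<in> carrier_mat r c \<Longrightarrow> B \<in> carrier_mat r d \<Longrightarrow> hcat A B \<in> carrier_mat r (c + d)"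
  by (auto simp: hcat_def)

lemma vcat_carrier [simp]:
  "A \<in> carrier_mat r c \<Longrightarrow> B \<in> carrier_mat s c \<Longrightarrow> vcat A B \<in> carrier_mat (r + s) c"
  by (auto simp: vcat_def)

lemma hcat_mult_vcat:
  fixes A :: "'a :: comm_ring_1 mat"
  assumes "A \<in> carrier_mat r c" "B \<in> carrier_mat r d" "C \<in> carrier_mat c s" "D \<in> carrier_mat d s"
  shows "hcat A B * vcat C D = A * C + B * D"
proof -
  have "hcat A B * vcat C D = four_block_mat (A * C + B * D) (0\<^sub>m r 0) (0\<^sub>m 0 s) (0\<^sub>m 0 0)"
    using assms unfolding hcat_def vcat_def
    by (subst mult_four_block_mat[where ?nr1.0 = r and ?n1.0 = c and ?n2.0 = d and ?nr2.0 = 0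
          and ?nc1.0 = s and ?nc2.0 = 0]) (auto intro!: cong_four_block_mat eq_matI)
  also have "\<dots> = A * C + B * D" using assms by (intro eq_matI) auto
  finally show ?thesis .
qed

lemma vcat_mult_hcat:
  fixes A :: "'a :: comm_ring_1 mat"
  assumes "A \<in> carrier_mat r c" "B \<in> carrier_mat s c" "C \<in> carrier_mat c t" "D \<in> carrier_mat c u"
  shows "vcat A B * hcat C D = four_block_mat (A * C) (A * D) (B * C) (B * D)"
  using assms unfolding hcat_def vcat_def
  by (subst mult_four_block_mat[where ?nr1.0 = r and ?n1.0 = c and ?n2.0 = 0 and ?nr2.0 = s
        and ?nc1.0 = t and ?nc2.0 = u]) (auto intro!: cong_four_block_mat eq_matI simp: scalar_prod_def)

lemma vcat_mult:
  fixes A :: "'a :: comm_ring_1 mat"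
  assumes "A \<in> carrier_mat r c" "B \<in> carrier_mat s c" "C \<in> carrier_mat c t"
  shows "vcat A B * C = vcat (A * C) (B * C)"
  using assms by (intro eq_matI) (auto simp: vcat_def scalar_prod_def)

lemma mult_hcat:
  fixes A :: "'a :: comm_ring_1 mat"
  assumes "A \<in> carrier_mat r c" "B \<in> carrier_mat c s" "C \<in> carrier_mat c t"
  shows "A * hcat B C = hcat (A * B) (A * C)"
  using assms by (intro eq_matI) (auto simp: hcat_def scalar_prod_def)

text \<open>Subtracting from \<open>X\<close> its component \<open>N * (H * X)\<close> keeps
  \<open>K * Y = 1\<close> because \<open>K * N = 0\<close>, and makes \<open>H * Y\<close> vanish.
  Then \<open>K\<close> stacked on \<open>H\<close> and \<open>Y\<close> next to \<open>N\<close>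
  are square and mutually inverse; the product in the other order is the last equation.\<close>

lemma ex_dual_completion:
  fixes K :: "'a :: idom mat"
  assumes K: "K \<in> carrier_mat p (p + n)" and N: "N \<in> carrier_mat (p + n) n"
    and X: "X \<in> carrier_mat (p + n) p" and H: "H \<in> carrier_mat n (p + n)"
    and KX: "K * X = 1\<^sub>m p" and HN: "H * N = 1\<^sub>m n" and KN: "K * N = 0\<^sub>m p n"
  obtains Y where "Y \<in> carrier_mat (p + n) p" "K * Y = 1\<^sub>m p" "H * Y = 0\<^sub>m n p"
    "Y * K + N * H = 1\<^sub>m (p + n)"
proof -
  define Y where "Y = X - N * (H * X)"
  have HX: "H * X \<in> carrier_mat n p" using H X by simp
  have Y: "Y \<in> carrier_mat (p + n) p"
    unfolding Y_def by (rule minus_carrier_mat[OF mult_carrier_mat[OF N HX]])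
  have "K * Y = K * X - (K * N) * (H * X)"
    unfolding Y_def mult_minus_distrib_mat[OF K X mult_carrier_mat[OF N HX]]
    by (simp only: assoc_mult_mat[OF K N HX])
  hence KY: "K * Y = 1\<^sub>m p" using KX KN left_mult_zero_mat[OF HX] by (simp add: minus_zero_mat)
  have "H * Y = H * X - (H * N) * (H * X)"
    unfolding Y_def mult_minus_distrib_mat[OF H X mult_carrier_mat[OF N HX]]
    by (simp only: assoc_mult_mat[OF H N HX])
  hence HY: "H * Y = 0\<^sub>m n p" using HN left_mult_one_mat[OF HX] minus_r_inv_mat[OF HX] by simp
  have "vcat K H * hcat Y N = 1\<^sub>m (p + n)"
    using vcat_mult_hcat[OF K H Y N] KY HY KN HN by simp
  hence "hcat Y N * vcat K H = 1\<^sub>m (p + n)"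
    by (rule mat_left_inverse_of_right_inverse[OF vcat_carrier[OF K H] hcat_carrier[OF Y N]])
  hence "Y * K + N * H = 1\<^sub>m (p + n)"
    by (simp only: hcat_mult_vcat[OF Y N K H])
  thus ?thesis by (rule that[OF Y KY HY])
qed

lemma four_block_diag_eq_diag_block_mat:
  assumes "Q \<in> carrier_mat m n"
  shows "four_block_mat (1\<^sub>m p) (0\<^sub>m p (q + n)) (0\<^sub>m (q + m) p)
      (four_block_mat (1\<^sub>m q) (0\<^sub>m q n) (0\<^sub>m m q) Q) = diag_block_mat [1\<^sub>m (p + q), Q]"
  using assoc_four_block_mat[of "1\<^sub>m p" "1\<^sub>m q" Q] assms
  by (simp add: Let_def) (intro eq_matI; auto)

text \<open>Here \<open>A\<close> and \<open>B\<close> are the rows dual to \<open>R\<close> and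
  \<open>G\<close>, not the arbitrary constant matrices of the pencil. Column operations with
  \<open>R\<close> reduce \<open>M * W\<close> to its component along \<open>G\<close>, row
  operations with the identity inside \<open>K * W\<close> clear what remains beside
  \<open>B * M * N\<close>, and the identity blocks of sizes \<open>p'\<close> and \<open>p\<close>
  form the \<open>1\<^sub>m s\<close> of a linearization.\<close>

lemma linearization_block:
  fixes M :: "complex poly mat"
  assumes M: "M \<in> carrier_mat (p' + m) (p + n)"
    and A: "A \<in> carrier_mat p' (p' + m)" and B: "B \<in> carrier_mat m (p' + m)"
    and R: "R \<in> carrier_mat (p' + m) p'" and G: "G \<in> carrier_mat (p' + m) m"
    and K: "K \<in> carrier_mat p (p + n)" and H: "H \<in> carrier_mat n (p + n)"
    and X: "X \<in> carrier_mat (p + n) p" and N: "N \<in> carrier_mat (p + n) n"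
    and AR: "A * R = 1\<^sub>m p'" and AG: "A * G = 0\<^sub>m p' m"
    and BR: "B * R = 0\<^sub>m m p'" and BG: "B * G = 1\<^sub>m m"
    and RA: "R * A + G * B = 1\<^sub>m (p' + m)"
    and KX: "K * X = 1\<^sub>m p" and KN: "K * N = 0\<^sub>m p n"
    and HX: "H * X = 0\<^sub>m n p" and HN: "H * N = 1\<^sub>m n"
    and s: "p + p' > 0"
    and pencil: "pencil (four_block_mat M R K (0\<^sub>m p p'))"
  shows "linearization (four_block_mat M R K (0\<^sub>m p p')) (B * M * N)"
proof -
  define L where "L = four_block_mat M R K (0\<^sub>m p p')"
  define W where "W = hcat X N"
  \<comment> \<open>The part of \<open>B * M * W\<close> in the columns of \<open>X\<close>. It
    stands below the identity block of \<open>K * W\<close>, and the block \<open>- \<gamma>\<close>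
    of \<open>D\<close> removes it.\<close>
  define \<gamma> where "\<gamma> = B * M * X"
  define Q where "Q = B * M * N"
  define Z where "Z = M * W"
  define C where "C = vcat (0\<^sub>m p (p' + m)) B"
  define D where "D = vcat (1\<^sub>m p) (- \<gamma>)"
  define U where "U = four_block_mat A (0\<^sub>m p' p) C D"
  \<comment> \<open>\<open>U'\<close> and \<open>V'\<close> are explicit inverses, written down only
    to show that \<open>U\<close> and \<open>V\<close> are unimodular.\<close>
  define U' where "U' = four_block_mat R (hcat (G * \<gamma>) G) (0\<^sub>m p p') (hcat (1\<^sub>m p) (0\<^sub>m p m))"
  define V where "V = four_block_mat (0\<^sub>m (p + n) p') W (1\<^sub>m p') (- (A * Z))"
  define V' where "V' = four_block_mat (A * M) (1\<^sub>m p') (vcat K H) (0\<^sub>m (p + n) p')"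
  have W: "W \<in> carrier_mat (p + n) (p + n)" using X N by (simp add: W_def)
  have \<gamma>: "\<gamma> \<in> carrier_mat m p" using B M X by (simp add: \<gamma>_def)
  have Q: "Q \<in> carrier_mat m n" using B M N by (simp add: Q_def)
  have Z: "Z \<in> carrier_mat (p' + m) (p + n)" using W M by (simp add: Z_def)
  have C: "C \<in> carrier_mat (p + m) (p' + m)" using B by (simp add: C_def)
  have D: "D \<in> carrier_mat (p + m) p" using \<gamma> by (simp add: D_def)
  have L: "L \<in> carrier_mat (p' + m + p) (p + n + p')" using M unfolding L_def by auto
  have U: "U \<in> carrier_mat (p' + (p + m)) (p' + m + p)" using A D unfolding U_def by auto
  have V: "V \<in> carrier_mat (p + n + p') (p' + (p + n))" using A Z unfolding V_def by auto
  have U': "U' \<in> carrier_mat (p' + m + p) (p' + (p + m))"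
    using R unfolding U'_def by (intro four_block_carrier_mat) auto
  have V': "V' \<in> carrier_mat (p' + (p + n)) (p + n + p')"
    using A M unfolding V'_def by (intro four_block_carrier_mat) auto
  have KHW: "vcat K H * W = 1\<^sub>m (p + n)"
    unfolding W_def vcat_mult_hcat[OF K H X N] using KX KN HX HN by simp
  have VV1: "A * M * W + - (A * Z) = 0\<^sub>m p' (p + n)"
    unfolding Z_def using add_uminus_mat[of "A * (M * W)" p' "p + n"] assoc_mult_mat[OF A M W] A M W
    by simp
  have VV2: "vcat K H * 0\<^sub>m (p + n) p' = 0\<^sub>m (p + n) p'"
    by (rule right_mult_zero_mat[OF vcat_carrier[OF K H]])
  have "V' * V = four_block_mat (1\<^sub>m p') (0\<^sub>m p' (p + n)) (0\<^sub>m (p + n) p') (1\<^sub>m (p + n))"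
    unfolding V_def V'_def
    apply (subst mult_four_block_mat[of _ p' "p + n" _ p' _ "p + n" _ _ p' _ "p + n"])
    using A M K H W Z KHW VV1 VV2 by auto
  hence VV: "V' * V = 1\<^sub>m (p' + (p + n))" by simp
  have BG\<gamma>: "B * (G * \<gamma>) = \<gamma>" using assoc_mult_mat[OF B G \<gamma>] BG \<gamma> by simp
  have AG\<gamma>: "A * (G * \<gamma>) = 0\<^sub>m p' p" using assoc_mult_mat[OF A G \<gamma>] AG \<gamma> by simp
  have CR: "C * R = 0\<^sub>m (p + m) p'"
    unfolding C_def by (subst vcat_mult[OF _ B R]) (use R BR in \<open>auto simp: vcat_def\<close>)
  have 1: "C * hcat (G * \<gamma>) G = four_block_mat (0\<^sub>m p p) (0\<^sub>m p m) \<gamma> (1\<^sub>m m)"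
    unfolding C_def by (subst vcat_mult_hcat[OF _ B _ G]) (use G \<gamma> BG BG\<gamma> in auto)
  have 2: "D * hcat (1\<^sub>m p) (0\<^sub>m p m) = four_block_mat (1\<^sub>m p) (0\<^sub>m p m) (- \<gamma>) (0\<^sub>m m m)"
    unfolding D_def by (subst vcat_mult_hcat[of _ p p _ m]) (use \<gamma> in auto)
  have 3: "C * hcat (G * \<gamma>) G + D * hcat (1\<^sub>m p) (0\<^sub>m p m) = 1\<^sub>m (p + m)"
    unfolding 1 2 using \<gamma> by (subst add_four_block_mat[of _ p p _ m _ m]) (auto simp: add_uminus_mat)
  have 4: "A * hcat (G * \<gamma>) G = 0\<^sub>m p' (p + m)"
    by (subst mult_hcat[OF A _ G]) (use G \<gamma> AG AG\<gamma> in \<open>auto simp: hcat_def\<close>)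
  have 9: "0\<^sub>m p' p * (hcat (1\<^sub>m p) (0\<^sub>m p m) :: complex poly mat) = 0\<^sub>m p' (p + m)"
    by (rule left_mult_zero_mat) simp
  have "U * U' = four_block_mat (1\<^sub>m p') (0\<^sub>m p' (p + m)) (0\<^sub>m (p + m) p') (1\<^sub>m (p + m))"
    unfolding U_def U'_def
    apply (subst mult_four_block_mat[OF A _ C D R, where ?nc2.0 = "p + m"])
    using AR 3 4 CR A C D G \<gamma> 9 by auto
  hence UU: "U * U' = 1\<^sub>m (p' + (p + m))" by simp
  \<comment> \<open>\<open>Z\<close> is split along \<open>R\<close> and \<open>G\<close>. The block
    \<open>- (A * Z)\<close> of \<open>V\<close> cancels exactly the part along
    \<open>R\<close>.\<close>
  have "Z = (R * A + G * B) * Z" unfolding RA using Z by simp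
  also have "\<dots> = R * (A * Z) + G * (B * Z)"
    by (simp only: add_mult_distrib_mat[OF mult_carrier_mat[OF R A] mult_carrier_mat[OF G B] Z]
        assoc_mult_mat[OF R A Z] assoc_mult_mat[OF G B Z])
  finally have Z': "Z = R * (A * Z) + G * (B * Z)" .
  have AZ: "A * Z \<in> carrier_mat p' (p + n)" and GBZ: "G * (B * Z) \<in> carrier_mat (p' + m) (p + n)"
    using A B G Z by auto
  have RAZ: "R * (- (A * Z)) = - (R * (A * Z))"
    using uminus_mult_right_mat[of R "A * Z"] R A by simp
  have EF: "E + F + - E = F" if "E \<in> carrier_mat (p' + m) (p + n)" "F \<in> carrier_mat (p' + m) (p + n)"
    for E F :: "complex poly mat"
    using that by (intro eq_matI) auto
  have ZG: "Z + R * (- (A * Z)) = G * (B * Z)"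
    unfolding RAZ by (subst Z') (rule EF[OF mult_carrier_mat[OF R AZ] GBZ])
  have LV: "L * V = four_block_mat R (G * (B * Z)) (0\<^sub>m p p') (K * W)"
    unfolding L_def V_def
    apply (subst mult_four_block_mat[OF M R K _ _ W, where ?nc1.0 = p'])
    using ZG M R K W A Z by (auto simp: Z_def[symmetric])
  have BZ: "B * Z = hcat \<gamma> Q"
    unfolding Z_def W_def \<gamma>_def Q_def assoc_mult_mat[OF B M hcat_carrier[OF X N], symmetric]
    by (rule mult_hcat) (use B M X N in auto)
  have KW: "K * W = hcat (1\<^sub>m p) (0\<^sub>m p n)"
    unfolding W_def using mult_hcat[OF K X N] KX KN by simp
  have 5: "C * (G * (B * Z)) = four_block_mat (0\<^sub>m p p) (0\<^sub>m p n) \<gamma> Q"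
  proof -
    have "B * (G * (B * Z)) = B * Z"
      unfolding assoc_mult_mat[OF B G mult_carrier_mat[OF B Z], symmetric] BG
      by (rule left_mult_one_mat[OF mult_carrier_mat[OF B Z]])
    hence "C * (G * (B * Z)) = vcat (0\<^sub>m p (p + n)) (B * Z)"
      unfolding C_def by (simp only: vcat_mult[OF zero_carrier_mat B GBZ] left_mult_zero_mat[OF GBZ])
    also have "\<dots> = four_block_mat (0\<^sub>m p p) (0\<^sub>m p n) \<gamma> Q"
      unfolding BZ using \<gamma> Q by (intro eq_matI) (auto simp: vcat_def hcat_def)
    finally show ?thesis .
  qed
  have 6: "D * (K * W) = four_block_mat (1\<^sub>m p) (0\<^sub>m p n) (- \<gamma>) (0\<^sub>m m n)"
    unfolding D_def KW by (subst vcat_mult_hcat[of _ p p _ m]) (use \<gamma> in auto)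
  have 7: "C * (G * (B * Z)) + D * (K * W) = four_block_mat (1\<^sub>m p) (0\<^sub>m p n) (0\<^sub>m m p) Q"
    unfolding 5 6 using \<gamma> Q
    by (subst add_four_block_mat[of _ p p _ n _ m]) (auto simp: add_uminus_mat)
  have 8: "A * (G * (B * Z)) = 0\<^sub>m p' (p + n)"
    unfolding assoc_mult_mat[OF A G mult_carrier_mat[OF B Z], symmetric] AG
    by (rule left_mult_zero_mat[OF mult_carrier_mat[OF B Z]])
  have "U * (L * V) = four_block_mat (1\<^sub>m p') (0\<^sub>m p' (p + n)) (0\<^sub>m (p + m) p')
      (four_block_mat (1\<^sub>m p) (0\<^sub>m p n) (0\<^sub>m m p) Q)"
    unfolding U_def LV
    apply (subst mult_four_block_mat[OF A _ C D R, where ?nc2.0 = "p + n"])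
    using AR CR 7 8 A C D G B Z K W by auto
  hence ULV: "U * L * V = diag_block_mat [1\<^sub>m (p' + p), Q]"
    using four_block_diag_eq_diag_block_mat[OF Q, of p' p] assoc_mult_mat[OF U L V]
    by (simp only:)
  \<comment> \<open>\<open>U\<close> and \<open>V\<close> are square only after the sums of the
    block sizes are reassociated.\<close>
  have dims: "p' + m + p = p' + (p + m)" "p + n + p' = p' + (p + n)" by simp_all
  have "unimodular U"
    by (rule unimodular_if_right_inverse(1)[OF _ _ UU]) (use U U' in \<open>simp_all only: dims\<close>)
  moreover have "unimodular V"
    by (rule unimodular_if_right_inverse(2)[OF _ _ VV]) (use V V' in \<open>simp_all only: dims\<close>)
  moreover have "dim_col U = dim_row L" "dim_row V = dim_col L" using U L V by auto
  moreover have "p' + p > 0" using s by (simp add: add.commute)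
  ultimately have "linearization L Q"
    unfolding linearization_def using pencil[folded L_def] ULV by blast
  thus ?thesis by (simp add: L_def Q_def)
qed

text \<open>\<open>S\<close> times the adjugate of \<open>K * S\<close> is a right inverse of
  \<open>K\<close> up to the factor \<open>det (K * S)\<close>, and likewise for \<open>T\<close>;
  the Bezout combination of the two has factor 1. When \<open>S\<close> and \<open>T\<close> select
  columns, the determinants are maximal minors of \<open>K\<close>.\<close>

lemma ex_right_inverse_of_coprime_minors:
  fixes K :: "'a :: comm_ring_1 mat"
  assumes K: "K \<in> carrier_mat p q" and S: "S \<in> carrier_mat q p" and T: "T \<in> carrier_mat q p"
    and uv: "u * det (K * S) + v * det (K * T) = 1"
  obtains X where "X \<in> carrier_mat q p" "K * X = 1\<^sub>m p"
proof
  define S' where "S' = adj_mat (K * S)"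
  define T' where "T' = adj_mat (K * T)"
  have KS: "K * S \<in> carrier_mat p p" and KT: "K * T \<in> carrier_mat p p" using K S T by auto
  note S' = adj_mat[OF KS, folded S'_def] and T' = adj_mat[OF KT, folded T'_def]
  note SS = mult_carrier_mat[OF S S'(1)] and TT = mult_carrier_mat[OF T T'(1)]
  show "u \<cdot>\<^sub>m (S * S') + v \<cdot>\<^sub>m (T * T') \<in> carrier_mat q p" using S T S' T' by simp
  have "K * (u \<cdot>\<^sub>m (S * S') + v \<cdot>\<^sub>m (T * T')) = u \<cdot>\<^sub>m ((K * S) * S') + v \<cdot>\<^sub>m ((K * T) * T')"
    using mult_add_distrib_mat[OF K smult_carrier_mat[OF SS] smult_carrier_mat[OF TT], of u v]
    by (simp only: mult_smult_distrib[OF K SS] mult_smult_distrib[OF K TT]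
        assoc_mult_mat[OF K S S'(1)] assoc_mult_mat[OF K T T'(1)])
  also have "\<dots> = (u * det (K * S) + v * det (K * T)) \<cdot>\<^sub>m 1\<^sub>m p"
    unfolding S'(2) T'(2) by (intro eq_matI) auto
  finally show "K * (u \<cdot>\<^sub>m (S * S') + v \<cdot>\<^sub>m (T * T')) = 1\<^sub>m p"
    unfolding uv by auto
qed

section \<open>Homogenised Chebyshev polynomials and their block matrices\<close>

text \<open>Formally this is \<open>a ^ j\<close> times \<phi>_j(b/a), with the denominators
  cleared; hence the factor \<open>a\<^sup>2\<close> in the recurrence.\<close>

fun hcheb :: "complex poly \<Rightarrow> complex poly \<Rightarrow> cheb_kind \<Rightarrow> nat \<Rightarrow> complex poly" where
  "hcheb a b r 0 = 1"
| "hcheb a b r (Suc 0) = (case r of First \<Rightarrow> b | Second \<Rightarrow> 2 * b)"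
| "hcheb a b r (Suc (Suc j)) = 2 * b * hcheb a b r (Suc j) - a\<^sup>2 * hcheb a b r j"

lemma cheb_eq_hcheb: "cheb r j = hcheb 1 [:0, 1:] r j"
  by (induction r j rule: cheb.induct)
    (auto simp: numeral_poly split: cheb_kind.split)

text \<open>For \<open>p = 0\<close> this is the recurrence itself. In the step one index moves from
  \<open>q\<close> to \<open>p\<close>: the polynomial of index \<open>q + 2\<close> is expanded and
  the factors of the second kind are collected. The factor in \<open>p\<close> is of the second kind
  for either \<open>r\<close>, which matches the choice of \<open>Second\<close> for K_2 in both
  cases.\<close>

lemma hcheb_add:
  "hcheb a b r (Suc (Suc (p + q))) =
    hcheb a b Second (Suc p) * hcheb a b r (Suc q) - a\<^sup>2 * hcheb a b Second p * hcheb a b r q"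
proof (induction p arbitrary: q)
  case (Suc p)
  show ?case using Suc[of "Suc q"] by (simp add: algebra_simps)
qed simp

text \<open>The classical 2 T_j = U_j - U_(j-2) in homogeneous form, a case of the addition theorem.
  It is what the factor 1/2 of the body for \<epsilon> = 0 and the first kind answers to: K_1 is
  then empty, and the first kind has to come from the body.\<close>

lemma hcheb_First_conv_Second:
  "2 * hcheb a b First (Suc (Suc j)) = hcheb a b Second (Suc (Suc j)) - a\<^sup>2 * hcheb a b Second j"
proof -
  have eq: "hcheb a b First (Suc (Suc j)) = hcheb a b Second (Suc j) * b - a\<^sup>2 * hcheb a b Second j"
    using hcheb_add[of a b First j 0] by simp
  show ?thesis
    unfolding eq hcheb.simps(3)[of a b Second] by (simp add: algebra_simps)
qed

section \<open>Reversal of Chebyshev polynomials\<close>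

lemma degree_cheb: "degree (cheb r j) \<le> j"
proof (induction r j rule: cheb.induct)
  case (3 r j)
  have "degree ([:0, 2:] * cheb r (Suc j)) \<le> Suc (Suc j)"
    using degree_mult_le[of "[:0, 2:]" "cheb r (Suc j)"] 3 by simp
  thus ?case using 3 by (simp add: degree_diff_le)
qed (auto split: cheb_kind.split)

lemma coeff_rev_poly: "coeff (rev_poly g p) i = (if i \<le> g then coeff p (g - i) else 0)"
proof -
  have "coeff (rev_poly g p) i = (\<Sum>l\<le>g. if g - l = i then coeff p l else 0)"
    by (simp add: rev_poly_def coeff_sum)
  also have "\<dots> = (\<Sum>l\<le>g. if i \<le> g \<and> l = g - i then coeff p (g - i) else 0)"
    by (intro sum.cong) auto
  also have "\<dots> = (if i \<le> g then coeff p (g - i) else 0)"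
    by (cases "i \<le> g") auto
  finally show ?thesis .
qed

lemma rev_poly_diff: "rev_poly g (p - q) = rev_poly g p - rev_poly g q"
  by (simp add: poly_eq_iff coeff_rev_poly)

lemma rev_poly_smult: "rev_poly g (smult c p) = smult c (rev_poly g p)"
  by (simp add: poly_eq_iff coeff_rev_poly)

lemma rev_poly_sum: "rev_poly g (\<Sum>l\<in>A. f l) = (\<Sum>l\<in>A. rev_poly g (f l))"
  by (simp add: poly_eq_iff coeff_rev_poly coeff_sum)

lemma rev_poly_Suc: "degree p \<le> g \<Longrightarrow> rev_poly (Suc g) p = [:0, 1:] * rev_poly g p"
  by (auto simp: poly_eq_iff coeff_rev_poly coeff_pCons coeff_eq_0 Suc_diff_le split: nat.split)

lemma rev_poly_Suc_mult: "rev_poly (Suc g) ([:0, c:] * p) = smult c (rev_poly g p)"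
  by (auto simp: poly_eq_iff coeff_rev_poly coeff_pCons Suc_diff_le le_Suc_eq split: nat.split)

lemma rev_poly_cheb_degree: "rev_poly j (cheb r j) = hcheb [:0, 1:] 1 r j"
proof (induction r j rule: cheb.induct)
  case (1 r)
  show ?case by (simp add: rev_poly_def)
next
  case (2 r)
  show ?case by (simp add: rev_poly_def monom_0 monom_Suc numeral_poly split: cheb_kind.split)
next
  case (3 r j)
  \<comment> \<open>In the recurrence this term is reversed at a grade two above its index, and the
    resulting square of \<lambda> is the \<open>a\<^sup>2\<close> of \<open>hcheb\<close>.\<close>
  have "rev_poly (Suc (Suc j)) (cheb r j) = [:0, 1:] * ([:0, 1:] * rev_poly j (cheb r j))"
    using degree_cheb[of r j] by (simp add: rev_poly_Suc)
  moreover have "smult 2 p = 2 * 1 * p" for p :: "complex poly"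
    by (simp add: numeral_poly)
  ultimately show ?case
    by (simp only: 3 cheb.simps hcheb.simps rev_poly_diff rev_poly_Suc_mult power2_eq_square mult.assoc)
qed

lemma rev_poly_cheb: "j \<le> k \<Longrightarrow> rev_poly k (cheb r j) = [:0, 1:] ^ (k - j) * hcheb [:0, 1:] 1 r j"
proof (induction k rule: dec_induct)
  case base
  show ?case by (simp add: rev_poly_cheb_degree)
next
  case (step g)
  have "degree (cheb r j) \<le> g" using degree_cheb[of r j] step by simp
  thus ?case using step by (simp add: rev_poly_Suc Suc_diff_le del: mult_pCons_left)
qed

section \<open>Homogenisation of pencils\<close>

text \<open>Homogenisation at grade 1; coefficients beyond the linear one are dropped.\<close>

definition hpoly :: "complex poly \<Rightarrow> complex poly \<Rightarrow> complex poly \<Rightarrow> complex poly" where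
  "hpoly a b p = smult (coeff p 0) a + smult (coeff p 1) b"

lemma hpoly_0 [simp]: "hpoly a b 0 = 0"
  by (simp add: hpoly_def)

lemma hpoly_add: "hpoly a b (p + q) = hpoly a b p + hpoly a b q"
  by (simp add: hpoly_def smult_add_left)

lemma hpoly_smult: "hpoly a b (smult c p) = smult c (hpoly a b p)"
  by (simp add: hpoly_def smult_add_right)

lemma hpoly_sum: "hpoly a b (\<Sum>l\<in>A. f l) = (\<Sum>l\<in>A. hpoly a b (f l))"
  by (induction A rule: infinite_finite_induct) (simp_all add: hpoly_add)

abbreviation hmat :: "complex poly \<Rightarrow> complex poly \<Rightarrow> complex poly mat \<Rightarrow> complex poly mat" where
  "hmat a b \<equiv> map_mat (hpoly a b)"

lemma hpoly_ident: "degree p \<le> 1 \<Longrightarrow> hpoly 1 [:0, 1:] p = p"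
  by (auto simp: hpoly_def poly_eq_iff coeff_pCons coeff_eq_0 split: nat.split)

text \<open>Turns the degree bound into an equation, so that it passes through sums, products and
  blocks by the same rewriting as the homogenisation.\<close>

lemma pencil_iff_hmat_ident: "pencil Q \<longleftrightarrow> hmat 1 [:0, 1:] Q = Q"
proof
  assume "pencil Q"
  thus "hmat 1 [:0, 1:] Q = Q"
    by (intro eq_matI) (auto simp: has_grade_def intro!: hpoly_ident)
next
  assume eq: "hmat 1 [:0, 1:] Q = Q"
  have "degree (hpoly 1 [:0, 1:] p) \<le> 1" for p
    by (simp add: hpoly_def degree_add_le)
  thus "pencil Q"
    unfolding has_grade_def by (metis eq index_map_mat(1))
qed

lemma hmat_eq_rev_mat: "hmat [:0, 1:] 1 Q = rev_mat 1 Q"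
proof -
  have "hpoly [:0, 1:] 1 = rev_poly 1"
    by (rule ext) (auto simp: hpoly_def poly_eq_iff coeff_rev_poly coeff_pCons le_Suc_eq split: nat.split)
  thus ?thesis by (simp only: rev_mat_def)
qed

lemma pencil_rev_mat: "pencil (rev_mat 1 Q)"
  by (auto simp: has_grade_def rev_mat_def intro!: degree_le simp: coeff_rev_poly)

lemma hmat_add:
  "A \<in> carrier_mat p q \<Longrightarrow> B \<in> carrier_mat p q \<Longrightarrow> hmat a b (A + B) = hmat a b A + hmat a b B"
  by (intro eq_matI) (auto simp: hpoly_add)

text \<open>\<open>hpoly\<close> is linear over the constants but not multiplicative, so one factor
  has to be constant. This covers the products with the arbitrary matrices in the pencil.\<close>

lemma hmat_const_mult:
  assumes "A \<in> carrier_mat p q" "K \<in> carrier_mat q s"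
  shows "hmat a b (const_mat A * K) = const_mat A * hmat a b K"
  using assms by (intro eq_matI) (auto simp: const_mat_def scalar_prod_def hpoly_sum hpoly_smult)

lemma hmat_mult_const:
  assumes "A \<in> carrier_mat q s" "K \<in> carrier_mat p q"
  shows "hmat a b (K * const_mat A) = hmat a b K * const_mat A"
  using assms by (intro eq_matI) (auto simp: const_mat_def scalar_prod_def hpoly_sum hpoly_smult)

lemma hmat_transpose: "hmat a b (transpose_mat K) = transpose_mat (hmat a b K)"
  by (intro eq_matI) auto

lemma hmat_zero: "hmat a b (0\<^sub>m p q) = 0\<^sub>m p q"
  by (intro eq_matI) auto

section \<open>Kronecker products with an identity matrix\<close>

text \<open>The Kronecker product of the \<open>p \<times> q\<close> matrix \<open>f\<close> with the identity of size \<open>n\<close>.\<close>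

definition kblocks :: "nat \<Rightarrow> nat \<Rightarrow> nat \<Rightarrow> (nat \<Rightarrow> nat \<Rightarrow> 'a) \<Rightarrow> 'a :: zero mat" where
  "kblocks p q n f =
    mat (p * n) (q * n) (\<lambda>(i, j). if i mod n = j mod n then f (i div n) (j div n) else 0)"

lemma kblocks_carrier [simp]: "kblocks p q n f \<in> carrier_mat (p * n) (q * n)"
  by (simp add: kblocks_def)

lemma kblocks_dim [simp]: "dim_row (kblocks p q n f) = p * n" "dim_col (kblocks p q n f) = q * n"
  by (simp_all add: kblocks_def)

lemma transpose_kblocks: "transpose_mat (kblocks p q n f) = kblocks q p n (\<lambda>t c. f c t)"
  by (intro eq_matI) (auto simp: kblocks_def)

lemma block_index_less: "c < (q::nat) \<Longrightarrow> j < n \<Longrightarrow> c * n + j < q * n"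
  using mult_le_mono1[of "Suc c" q n] by simp

text \<open>Each block of \<open>n\<close> consecutive indices contains exactly one index that is
  congruent to \<open>j\<close>.\<close>

lemma sum_block_column:
  fixes g f :: "nat \<Rightarrow> 'a :: comm_semiring_0"
  assumes "j < n"
  shows "(\<Sum>i<q * n. g i * (if i mod n = j then f (i div n) else 0)) = (\<Sum>c<q. g (c * n + j) * f c)"
proof -
  have "(\<Sum>i\<in>{c * n..<c * n + n}. g i * (if i mod n = j then f (i div n) else 0)) = g (c * n + j) * f c"
    for c
  proof -
    have "(\<Sum>i\<in>{c * n..<c * n + n}. g i * (if i mod n = j then f (i div n) else 0)) =
        (\<Sum>i\<in>{c * n..<c * n + n}. if i = c * n + j then g i * f c else 0)"
    proof (rule sum.cong)
      fix i assume i: "i \<in> {c * n..<c * n + n}"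
      then obtain l where l: "i = c * n + l" "l < n"
        by (metis add_less_cancel_left atLeastLessThan_iff le_Suc_ex)
      thus "g i * (if i mod n = j then f (i div n) else 0) = (if i = c * n + j then g i * f c else 0)"
        by simp
    qed simp
    thus ?thesis using assms by (simp add: sum.delta)
  qed
  thus ?thesis
    by (simp add: sum.nat_group[symmetric])
qed

lemma mult_kblocks_index:
  fixes A :: "'a :: comm_semiring_0 mat"
  assumes "A \<in> carrier_mat p (q * n)" "i < p" "j < s * n"
  shows "(A * kblocks q s n f) $$ (i, j) = (\<Sum>c<q. A $$ (i, c * n + j mod n) * f c (j div n))"
proof -
  have n: "n > 0" using assms(3) by (cases n) auto
  have "(A * kblocks q s n f) $$ (i, j) =
      (\<Sum>l<q * n. A $$ (i, l) * (if l mod n = j mod n then f (l div n) (j div n) else 0))"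
    using assms by (simp add: scalar_prod_def kblocks_def lessThan_atLeast0)
  also have "\<dots> = (\<Sum>c<q. A $$ (i, c * n + j mod n) * f c (j div n))"
    using n by (intro sum_block_column) simp
  finally show ?thesis .
qed

lemma kblocks_mult_index:
  fixes A :: "'a :: comm_semiring_0 mat"
  assumes "A \<in> carrier_mat (q * n) p" "i < s * n" "j < p"
  shows "(kblocks s q n f * A) $$ (i, j) = (\<Sum>c<q. f (i div n) c * A $$ (c * n + i mod n, j))"
proof -
  have n: "n > 0" using assms(2) by (cases n) auto
  have "(kblocks s q n f * A) $$ (i, j) =
      (\<Sum>l<q * n. A $$ (l, j) * (if l mod n = i mod n then f (i div n) (l div n) else 0))"
    using assms by (auto simp: scalar_prod_def kblocks_def lessThan_atLeast0 mult.commute intro!: sum.cong)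
  also have "\<dots> = (\<Sum>c<q. A $$ (c * n + i mod n, j) * f (i div n) c)"
    using n by (intro sum_block_column) simp
  finally show ?thesis by (simp add: mult.commute)
qed

lemma kblocks_mult_kblocks:
  fixes f g :: "nat \<Rightarrow> nat \<Rightarrow> 'a :: comm_semiring_0"
  shows "kblocks p q n f * kblocks q s n g = kblocks p s n (\<lambda>t c. \<Sum>l<q. f t l * g l c)"
proof (cases "n = 0")
  case False
  show ?thesis
  proof (rule eq_matI)
    fix i j assume "i < dim_row (kblocks p s n (\<lambda>t c. \<Sum>l<q. f t l * g l c))"
      "j < dim_col (kblocks p s n (\<lambda>t c. \<Sum>l<q. f t l * g l c))"
    hence ij: "i < p * n" "j < s * n" by auto
    have "(kblocks p q n f * kblocks q s n g) $$ (i, j) =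
        (\<Sum>c<q. kblocks p q n f $$ (i, c * n + j mod n) * g c (j div n))"
      by (rule mult_kblocks_index) (use ij in auto)
    also have "\<dots> = (\<Sum>c<q. (if i mod n = j mod n then f (i div n) c else 0) * g c (j div n))"
      using ij False by (intro sum.cong) (auto simp: kblocks_def block_index_less)
    finally show "(kblocks p q n f * kblocks q s n g) $$ (i, j) =
        kblocks p s n (\<lambda>t c. \<Sum>l<q. f t l * g l c) $$ (i, j)"
      using ij by (simp add: kblocks_def)
  qed auto
qed (auto simp: kblocks_def)

lemma kblocks_cong:
  assumes "\<And>t c. t < p \<Longrightarrow> c < q \<Longrightarrow> f t c = g t c"
  shows "kblocks p q n f = kblocks p q n g"
  using assms by (intro eq_matI) (auto simp: kblocks_def less_mult_imp_div_less)

lemma kblocks_zero: "kblocks p q n (\<lambda>_ _. 0) = 0\<^sub>m (p * n) (q * n)"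
  by (intro eq_matI) (auto simp: kblocks_def)

text \<open>Off the block diagonal nothing new can happen: an entry below the diagonal whose row and
  column are congruent modulo \<open>n\<close> lies in a block strictly below the diagonal.\<close>

lemma det_kblocks_upper_triangular:
  fixes f :: "nat \<Rightarrow> nat \<Rightarrow> 'a :: idom"
  assumes "\<And>t c. c < t \<Longrightarrow> t < p \<Longrightarrow> f t c = 0"
  shows "det (kblocks p p n f) = (\<Prod>i<p * n. f (i div n) (i div n))"
proof -
  have "upper_triangular (kblocks p p n f)"
  proof
    fix i j assume ij: "j < i" "i < dim_row (kblocks p p n f)"
    show "kblocks p p n f $$ (i, j) = 0"
    proof (cases "i mod n = j mod n")
      case True
      have "j div n \<noteq> i div n" using ij(1) True by (metis div_mult_mod_eq less_irrefl)
      hence "j div n < i div n" using ij(1) by (simp add: div_le_mono le_neq_implies_less)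
      thus ?thesis using ij assms by (auto simp: kblocks_def less_mult_imp_div_less)
    qed (use ij in \<open>auto simp: kblocks_def\<close>)
  qed
  from det_upper_triangular[OF this, of "p * n"] show ?thesis
    by (auto simp: prod_list_diag_prod kblocks_def lessThan_atLeast0)
qed


section \<open>The homogenised \<open>K\<close> and its null column\<close>

text \<open>The scalar in block (t, c) of the homogenised \<open>K\<close>, counted from 0. As a sum
  of three indicator terms it splits every sum over \<open>c\<close> into three single values; in
  the last row the third one falls outside the matrix.\<close>

definition cheb_kappa :: "complex poly \<Rightarrow> complex poly \<Rightarrow> cheb_kind \<Rightarrow> nat \<Rightarrow> nat \<Rightarrow> nat \<Rightarrow> complex poly" where
  "cheb_kappa a b r e t c =
    (if c = t then a else 0) + (if c = t + 1 then if t + 1 = e then - hcheb a b r 1 else - (2 * b) else 0)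
      + (if c = t + 2 then a else 0)"

lemma hmat_cheb_K: "hmat a b (cheb_K r e n) = kblocks e (e + 1) n (cheb_kappa a b r e)"
proof (cases "n = 0")
  case False
  have 1: "hpoly a b 1 = a" by (simp add: hpoly_def)
  have 2: "hpoly a b (- [:0, 2:]) = - (2 * b)" by (simp add: hpoly_def numeral_poly)
  have 3: "hpoly a b (- cheb r 1) = - hcheb a b r 1"
    by (simp add: hpoly_def numeral_poly split: cheb_kind.split)
  show ?thesis
    using False 1 2 3
    by (intro eq_matI) (auto simp: cheb_K_def block_mat_def kblocks_def cheb_kappa_def simp del: minus_pCons)
qed (auto simp: cheb_K_def block_mat_def kblocks_def)

lemma pencil_cheb_K: "pencil (cheb_K r e n)"
proof (cases "n = 0")
  case False
  thus ?thesis
    by (auto simp: has_grade_def cheb_K_def block_mat_def split: cheb_kind.split)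
qed (auto simp: has_grade_def cheb_K_def block_mat_def)

text \<open>The column \<phi>_e, ..., \<phi>_0 tensored with the identity, with all entries
  homogenised to the same degree \<open>e\<close>.\<close>

definition cheb_N :: "complex poly \<Rightarrow> complex poly \<Rightarrow> cheb_kind \<Rightarrow> nat \<Rightarrow> nat \<Rightarrow> complex poly mat" where
  "cheb_N a b r e n = kblocks (e + 1) 1 n (\<lambda>t _. a ^ t * hcheb a b r (e - t))"

text \<open>Row \<open>t\<close> is \<open>a ^ (t + 1)\<close> times the recurrence for the
  polynomial of index \<open>e - t\<close>. The last row only compares the polynomial of index 1
  with itself.\<close>

lemma cheb_kappa_mult_N:
  assumes "t < e"
  shows "(\<Sum>c<e + 1. cheb_kappa a b r e t c * (a ^ c * hcheb a b r (e - c))) = 0"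
proof -
  have "(\<Sum>c<e + 1. cheb_kappa a b r e t c * (a ^ c * hcheb a b r (e - c))) =
      (\<Sum>c<e + 1. if c = t then a * (a ^ t * hcheb a b r (e - t)) else 0) +
      (\<Sum>c<e + 1. if c = t + 1 then (if t + 1 = e then - hcheb a b r 1 else - (2 * b)) *
        (a ^ (t + 1) * hcheb a b r (e - (t + 1))) else 0) +
      (\<Sum>c<e + 1. if c = t + 2 then a * (a ^ (t + 2) * hcheb a b r (e - (t + 2))) else 0)"
    unfolding sum.distrib[symmetric]
    by (intro sum.cong) (auto simp: cheb_kappa_def)
  also have "\<dots> = a * (a ^ t * hcheb a b r (e - t)) +
      (if t + 1 = e then - hcheb a b r 1 else - (2 * b)) * (a ^ (t + 1) * hcheb a b r (e - (t + 1))) +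
      (if t + 2 \<le> e then a * (a ^ (t + 2) * hcheb a b r (e - (t + 2))) else 0)"
    using assms by (simp add: sum.delta)
  also have "\<dots> = 0"
  proof (cases "t + 2 \<le> e")
    case True
    then obtain l where "e = t + 2 + l" by (metis le_Suc_ex)
    thus ?thesis by (simp add: power2_eq_square algebra_simps)
  next
    case False
    hence "e = Suc t" using assms by simp
    thus ?thesis by (simp add: algebra_simps)
  qed
  finally show ?thesis .
qed

lemma hmat_cheb_K_mult_N: "hmat a b (cheb_K r e n) * cheb_N a b r e n = 0\<^sub>m (e * n) n"
proof -
  have "hmat a b (cheb_K r e n) * cheb_N a b r e n = kblocks e 1 n (\<lambda>_ _. 0)"
    unfolding hmat_cheb_K cheb_N_def kblocks_mult_kblocks
    by (rule kblocks_cong) (rule cheb_kappa_mult_N)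
  thus ?thesis by (simp add: kblocks_zero)
qed

section \<open>Bezout relations and the completion of \<open>K\<close>\<close>

text \<open>Covers the points (1, \<lambda>) and (\<lambda>, 1). In the first case \<open>a\<close>
  is a unit; in the second, being coprime to \<open>a\<close> means not vanishing at 0.\<close>

definition hom_point :: "complex poly \<Rightarrow> complex poly \<Rightarrow> bool" where
  "hom_point a b \<longleftrightarrow> a = 1 \<or> a = [:0, 1:] \<and> b = 1"

text \<open>A polynomial with nonzero constant term is a unit modulo every power of the
  indeterminate.\<close>

lemma bezout_X_power:
  fixes q :: "'a :: field poly"
  assumes "poly q 0 \<noteq> 0"
  shows "\<exists>u v. u * [:0, 1:] ^ N + v * q = 1"
proof (induction N)
  case 0
  show ?case by (intro exI[of _ 1] exI[of _ 0]) simp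
next
  case (Suc N)
  then obtain u v where uv: "u * [:0, 1:] ^ N + v * q = 1" by blast
  obtain c p where q: "q = pCons c p" by (cases q)
  have c: "c \<noteq> 0" using assms by (simp add: q)
  \<comment> \<open>By \<open>[:c:] = q - [:0, 1:] * p\<close>, the multiple of the
    \<open>N\<close>-th power in the old relation is a multiple of \<open>q\<close> minus a multiple
    of the next power.\<close>
  define w where "w = smult (1 / c) (u * [:0, 1:] ^ N)"
  have "u * [:0, 1:] ^ N = w * [:c:]"
    using c by (simp add: w_def)
  also have "[:c:] = q - [:0, 1:] * p"
    by (simp add: q)
  finally have "u * [:0, 1:] ^ N = w * q - w * [:0, 1:] * p"
    by (simp only: algebra_simps)
  moreover define s where "s = smult (1 / c) (u * p)"
  moreover have "w * [:0, 1:] * p = s * [:0, 1:] ^ Suc N"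
    by (simp add: w_def s_def algebra_simps del: mult_pCons_left mult_pCons_right)
  ultimately have "w * q - s * [:0, 1:] ^ Suc N + v * q = 1"
    using uv by simp
  hence "(- s) * [:0, 1:] ^ Suc N + (w + v) * q = 1"
    by (simp add: distrib_right diff_add_eq del: power_Suc)
  thus ?case by blast
qed

lemma bezout_hom_point:
  assumes "hom_point a b" and "a = [:0, 1:] \<Longrightarrow> b = 1 \<Longrightarrow> poly q 0 \<noteq> 0"
  shows "\<exists>u v. u * a ^ N + v * q = 1"
proof (cases "a = 1")
  case True
  thus ?thesis by (intro exI[of _ 1] exI[of _ 0]) simp
qed (use assms bezout_X_power in \<open>auto simp: hom_point_def\<close>)

text \<open>At 0 the term with \<open>a\<^sup>2\<close> drops out, so each step of the recurrence
  doubles the value. The result is the leading coefficient of \<phi>_j.\<close>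

lemma poly_hcheb_0: "poly (hcheb [:0, 1:] 1 r j) 0 \<noteq> 0"
proof (cases j)
  case (Suc l)
  show ?thesis unfolding Suc
  proof (induction l)
    case (Suc l)
    thus ?case by (simp)
  qed (simp split: cheb_kind.split)
qed simp

lemma poly_det_0: "poly (det Q) 0 = det (map_mat (\<lambda>p. poly p (0 :: 'a :: comm_ring_1)) Q)"
proof -
  interpret comm_ring_hom "\<lambda>p :: 'a poly. poly p 0"
    by unfold_locales auto
  show ?thesis by (rule hom_det[symmetric])
qed

text \<open>A right inverse of \<open>K\<close> and a left inverse of \<open>N\<close> are found
  separately from coprime minors, and \<open>ex_dual_completion\<close> then makes them
  compatible.\<close>

lemma ex_dual_hmat_cheb_K:
  fixes e n :: nat and r :: cheb_kind
  assumes ab: "hom_point a b" and n: "n > 0"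
  defines "K \<equiv> hmat a b (cheb_K r e n)" and "N \<equiv> cheb_N a b r e n"
  obtains Y H where "Y \<in> carrier_mat (e * n + n) (e * n)" "H \<in> carrier_mat n (e * n + n)"
    "K * Y = 1\<^sub>m (e * n)" "H * Y = 0\<^sub>m n (e * n)" "H * N = 1\<^sub>m n" "Y * K + N * H = 1\<^sub>m (e * n + n)"
proof -
  have K: "K \<in> carrier_mat (e * n) (e * n + n)"
    using kblocks_carrier[of e "e + 1" n] unfolding K_def hmat_cheb_K by (simp add: add.commute)
  have N: "N \<in> carrier_mat (e * n + n) n"
    using kblocks_carrier[of "e + 1" 1 n] unfolding N_def cheb_N_def by (simp add: add.commute)
  have S: "kblocks (e + 1) e n f \<in> carrier_mat (e * n + n) (e * n)" for f :: "nat \<Rightarrow> nat \<Rightarrow> complex poly"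
    using kblocks_carrier[of "e + 1" e n] by (simp add: add.commute)
  define \<kappa> where "\<kappa> = cheb_kappa a b r e"
  \<comment> \<open>\<open>S1\<close> selects the first \<open>e\<close> block columns of
    \<open>K\<close>, which are upper triangular with diagonal \<open>a\<close>. \<open>S2\<close>
    selects the last \<open>e\<close>, which are tridiagonal with \<open>a\<close> next to the
    diagonal.\<close>
  define S1 where "S1 = kblocks (e + 1) e n (\<lambda>t c. if t = c then 1 else 0 :: complex poly)"
  define S2 where "S2 = kblocks (e + 1) e n (\<lambda>t c. if t = c + 1 then 1 else 0 :: complex poly)"
  have KS1: "K * S1 = kblocks e e n \<kappa>"
    unfolding K_def S1_def hmat_cheb_K kblocks_mult_kblocks \<kappa>_def
    by (rule kblocks_cong) (simp add: if_distrib[of "(*) _"] sum.delta cong: if_cong)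
  have KS2: "K * S2 = kblocks e e n (\<lambda>t c. \<kappa> t (c + 1))"
    unfolding K_def S2_def hmat_cheb_K kblocks_mult_kblocks \<kappa>_def
    by (rule kblocks_cong) (simp add: if_distrib[of "(*) _"] sum.delta cong: if_cong)
  have det1: "det (K * S1) = a ^ (e * n)"
    unfolding KS1 by (subst det_kblocks_upper_triangular) (auto simp: \<kappa>_def cheb_kappa_def)
  \<comment> \<open>At \<lambda> = 0 the neighbours of the diagonal vanish, and the diagonal entries
    are -2 or minus the value of the polynomial of index 1.\<close>
  have "poly (det (K * S2)) 0 \<noteq> 0" if X: "a = [:0, 1:]" "b = 1"
  proof -
    have "map_mat (\<lambda>p. poly p 0) (K * S2) = kblocks e e n (\<lambda>t c. poly (\<kappa> t (c + 1)) 0)"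
      unfolding KS2 by (intro eq_matI) (auto simp: kblocks_def)
    hence "poly (det (K * S2)) 0 = det (kblocks e e n (\<lambda>t c. poly (\<kappa> t (c + 1)) 0))"
      by (simp add: poly_det_0)
    also have "\<dots> = (\<Prod>i<e * n. poly (\<kappa> (i div n) (i div n + 1)) 0)"
      by (rule det_kblocks_upper_triangular) (auto simp: \<kappa>_def cheb_kappa_def X)
    also have "\<dots> \<noteq> 0"
      using poly_hcheb_0[of r 1] by (auto simp: \<kappa>_def cheb_kappa_def X simp del: hcheb.simps)
    finally show ?thesis .
  qed
  then obtain u v where "u * det (K * S1) + v * det (K * S2) = 1"
    using bezout_hom_point[OF ab, of "det (K * S2)" "e * n"] det1 by auto
  then obtain Y where Y: "Y \<in> carrier_mat (e * n + n) (e * n)" "K * Y = 1\<^sub>m (e * n)"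
    using ex_right_inverse_of_coprime_minors[OF K S S] unfolding S1_def S2_def by metis
  \<comment> \<open>\<open>T1\<close> and \<open>T2\<close> pick the last and the first block of
    \<open>N\<close>, namely \<open>a ^ e\<close> and the polynomial of index \<open>e\<close>, each
    times the identity. A left inverse of \<open>N\<close> is the transpose of a right inverse of
    its transpose.\<close>
  define T1 where "T1 = kblocks (e + 1) 1 n (\<lambda>t _. if t = e then 1 else 0 :: complex poly)"
  define T2 where "T2 = kblocks (e + 1) 1 n (\<lambda>t _. if t = 0 then 1 else 0 :: complex poly)"
  have T: "T1 \<in> carrier_mat (e * n + n) n" "T2 \<in> carrier_mat (e * n + n) n"
    using kblocks_carrier[of "e + 1" 1 n] unfolding T1_def T2_def by (simp_all add: add.commute)
  have NT: "transpose_mat N \<in> carrier_mat n (e * n + n)" using N by simp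
  have NT1eq: "transpose_mat N * T1 = kblocks 1 1 n (\<lambda>_ _. a ^ e)"
    unfolding N_def cheb_N_def transpose_kblocks T1_def kblocks_mult_kblocks
    by (rule kblocks_cong) (simp add: if_distrib[of "(*) _"] sum.delta cong: if_cong)
  have NT2: "transpose_mat N * T2 = kblocks 1 1 n (\<lambda>_ _. hcheb a b r e)"
    unfolding N_def cheb_N_def transpose_kblocks T2_def kblocks_mult_kblocks
    by (rule kblocks_cong) (simp add: if_distrib[of "(*) _"] sum.delta cong: if_cong)
  have dets: "det (transpose_mat N * T1) = a ^ (e * n)" "det (transpose_mat N * T2) = hcheb a b r e ^ n"
    unfolding NT1eq NT2 by (subst det_kblocks_upper_triangular; simp add: power_mult)+
  have "a = [:0, 1:] \<Longrightarrow> b = 1 \<Longrightarrow> poly (hcheb a b r e ^ n) 0 \<noteq> 0"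
    using poly_hcheb_0[of r e] by (simp add: poly_power)
  then obtain u v where "u * det (transpose_mat N * T1) + v * det (transpose_mat N * T2) = 1"
    unfolding dets using bezout_hom_point[OF ab] by metis
  then obtain G where G: "G \<in> carrier_mat (e * n + n) n" "transpose_mat N * G = 1\<^sub>m n"
    using ex_right_inverse_of_coprime_minors[OF NT T] by metis
  have "transpose_mat G * N = (transpose_mat N * G)\<^sup>T" using transpose_mult[OF NT G(1)] by simp
  hence HN: "transpose_mat G * N = 1\<^sub>m n" by (simp add: G(2))
  have H: "transpose_mat G \<in> carrier_mat n (e * n + n)" using G by simp
  have KN: "K * N = 0\<^sub>m (e * n) n" unfolding K_def N_def by (rule hmat_cheb_K_mult_N)
  obtain Z where "Z \<in> carrier_mat (e * n + n) (e * n)" "K * Z = 1\<^sub>m (e * n)"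
    "transpose_mat G * Z = 0\<^sub>m n (e * n)" "Z * K + N * transpose_mat G = 1\<^sub>m (e * n + n)"
    using ex_dual_completion[OF K N Y(1) H Y(2) HN KN] by metis
  thus ?thesis using that[of Z "transpose_mat G"] H HN by blast
qed

section \<open>The body of the pencil\<close>

text \<open>The coefficient of block \<open>(t, c)\<close> of the homogenised body, counted from 0, when \<open>P\<^sub>l\<close> is the scalar
  \<open>x l\<close>. For \<open>\<epsilon> \<ge> 1\<close> the overlapping corner entries of the definition become sums of three
  patterns: first column, second column, last row.\<close>

definition cheb_F ::
    "complex poly \<Rightarrow> complex poly \<Rightarrow> cheb_kind \<Rightarrow> nat \<Rightarrow> nat \<Rightarrow> (nat \<Rightarrow> complex poly) \<Rightarrow> nat \<Rightarrow> nat \<Rightarrow> complex poly"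
  where
  "cheb_F a b r k e x t c =
    (if r = First \<and> e = 0 then
       smult (1/2) ((if t = 0 then 2 * b * x k else 0) + a * x (k - 1 - t)
         - (if t = 0 then 0 else a * x (k + 1 - t)) - (if t = 1 then a * x k else 0)
         + (if t = k - 1 then a * x 0 else 0))
     else (case c of
         0 \<Rightarrow> (if t = 0 then 2 * b * x k else 0) + a * x (k - 1 - t) - (if t = 1 then a * x k else 0)
       | Suc c' \<Rightarrow> (if t = k - e - 1 then a * x (e - 1 - c') else 0) - (if c' = 0 then a * x (k - t) else 0)))"

lemma block_mat_index:
  assumes "i < p * u" "j < q * v"
  shows "block_mat p q u v F $$ (i, j) = F (i div u + 1) (j div v + 1) $$ (i mod u, j mod v)"
  using assms by (simp add: block_mat_def)

text \<open>An entrywise comparison of the cases of the definition with the single formula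
  \<open>cheb_F\<close>. A corner entry with two coefficients arises where two patterns meet; for
  \<open>e = k - 1\<close> the only block row is the first and the last at once.\<close>

lemma cheb_M_eq:
  assumes k: "k \<ge> 2" and e: "e \<le> k - 1" and m: "m > 0" and n: "n > 0"
    and P: "\<And>i. i \<le> k \<Longrightarrow> P i \<in> carrier_mat m n"
  shows "cheb_M r k m n e P =
    mat ((k - e) * m) ((e + 1) * n)
      (\<lambda>(i, j). cheb_F 1 [:0, 1:] r k e (\<lambda>l. [:P l $$ (i mod m, j mod n):]) (i div m) (j div n))" (is "?L = ?R")
proof (rule eq_matI)
  have ek: "e + 1 = k" if "e = k - 1" using that k by simp
  have dims: "dim_row (cheb_M r k m n e P) = (k - e) * m" "dim_col (cheb_M r k m n e P) = (e + 1) * n"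
    using k e ek by (auto simp: cheb_M_def Let_def block_mat_def simp del: mult_Suc split: cheb_kind.split)
  thus "dim_row ?L = dim_row ?R" "dim_col ?L = dim_col ?R" by simp_all
  fix i j assume "i < dim_row ?R" "j < dim_col ?R"
  hence i: "i < (k - e) * m" and j: "j < (e + 1) * n" by auto
  define t where "t = i div m"
  define c where "c = j div n"
  define i' where "i' = i mod m"
  define j' where "j' = j mod n"
  have t: "t < k - e" and c: "c < e + 1"
    using i j by (auto simp: t_def c_def less_mult_imp_div_less simp del: mult_Suc)
  have ij': "i' < m" "j' < n" using m n by (auto simp: i'_def j'_def)
  define Q where "Q = (\<lambda>i. const_mat (P i))"
  have Q: "Q l \<in> carrier_mat m n" "Q l $$ (i', j') = [:P l $$ (i', j'):]" if "l \<le> k" for l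
    using P[OF that] ij' by (auto simp: Q_def const_mat_def)
  have dim: "dim_row (Q l) = m" "dim_col (Q l) = n" if "l \<le> k" for l using Q(1)[OF that] by auto
  define x where "x = (\<lambda>l. [:P l $$ (i', j'):])"
  have Qx: "Q l $$ (i', j') = x l" if "l \<le> k" for l using Q(2)[OF that] by (simp add: x_def)
  have Qf: "const_mat (P l) = Q l" for l by (simp add: Q_def)
  have two: "[:0, 2:] = 2 * [:0, 1 :: complex:]" by (simp add: numeral_poly)
  have top: "([:0, 2:] \<cdot>\<^sub>m Q k + Q (k - 1)) $$ (i', j') = [:0, 2:] * x k + x (k - 1)"
    using ij' by (simp add: dim Qx del: mult_pCons_left)
  note top = top[unfolded One_nat_def]
  have diff: "(Q l - Q l') $$ (i', j') = x l - x l'" if "l \<le> k" "l' \<le> k" for l l'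
    using ij' that by (simp add: dim Qx)
  have neg: "(- Q l) $$ (i', j') = - x l" if "l \<le> k" for l
    using ij' that by (simp add: dim Qx)
  have "cheb_M r k m n e P $$ (i, j) = cheb_F 1 [:0, 1:] r k e x t c"
  proof -
    consider "1 \<le> e" "e \<le> k - 2" | "e = k - 1" "e \<ge> 1" | "e = 0" using k e by linarith
    thus ?thesis
    proof cases
      case 1
      have "cheb_M r k m n e P $$ (i, j) =
        (if c + 1 = 1 then
           (if t + 1 = 1 then [:0, 2:] \<cdot>\<^sub>m Q k + Q (k - 1)
            else if t + 1 = 2 then Q (k - 2) - Q k
            else Q (k - (t + 1)))
         else if c + 1 = 2 then
           (if t + 1 \<le> k - e - 1 then - Q (k + 1 - (t + 1))
            else Q (e - 1) - Q (e + 1))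
         else
           (if t + 1 = k - e then Q (e + 1 - (c + 1)) else 0\<^sub>m m n)) $$ (i', j')"
        unfolding cheb_M_def Let_def Qf if_P[OF conjI[OF 1]] block_mat_index[OF i j]
        by (simp only: t_def c_def i'_def j'_def)
      also have "\<dots> =
        (if c = 0 then if t = 0 then [:0, 2:] * x k + x (k - 1) else if t = 1 then x (k - 2) - x k else x (k - 1 - t)
         else if c = 1 then if t < k - e - 1 then - x (k - t) else x (e - 1) - x (e + 1)
         else if t = k - e - 1 then x (e - c) else 0)"
      proof -
        have tk: "Suc t = k - e \<longleftrightarrow> t = k - Suc e" using t by linarith
        consider "c = 0" | "c = 1" | "c \<ge> 2" by linarith
        thus ?thesis
          by cases (use 1 k t ij' tk in \<open>simp_all add: top diff neg Qx Suc_le_eq less_diff_conv del: mult_pCons_left\<close>)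
      qed
      finally have M: "cheb_M r k m n e P $$ (i, j) = \<dots>" .
      have F: "\<not> (r = First \<and> e = 0)" using 1 by simp
      consider "c = 0" | "c = 1" | c' where "c = Suc (Suc c')" by (metis One_nat_def old.nat.exhaust)
      thus ?thesis unfolding M cheb_F_def if_not_P[OF F]
        by cases (use 1 k t in \<open>auto simp: two mult.assoc numeral_2_eq_2 simp del: mult_pCons_left mult_pCons_right\<close>)
    next
      case 2
      have ek: "e + 1 = k" "k - e = 1" using 2 k by auto
      have t0: "t = 0" using t ek by simp
      have "cheb_M r k m n e P $$ (i, j) =
          (if c + 1 = 1 then [:0, 2:] \<cdot>\<^sub>m Q k + Q (k - 1)
           else if c + 1 = 2 then Q (k - 2) - Q k
           else Q (k - (c + 1))) $$ (i', j')"
      proof -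
        have e2: "\<not> (1 \<le> e \<and> e \<le> k - 2)" using 2 by linarith
        show ?thesis
          unfolding cheb_M_def Let_def Qf if_not_P[OF e2] if_P[OF 2(1)]
            block_mat_index[OF i[unfolded ek(2)] j[unfolded ek(1)]]
          by (simp only: t_def c_def i'_def j'_def)
      qed
      also have "\<dots> =
        (if c = 0 then [:0, 2:] * x k + x (k - 1) else if c = 1 then x (k - 2) - x k else x (k - 1 - c))"
        using k by (simp add: top diff Qx del: mult_pCons_left)
      finally have M: "cheb_M r k m n e P $$ (i, j) = \<dots>" .
      have F: "\<not> (r = First \<and> e = 0)" using 2(2) by linarith
      consider "c = 0" | "c = 1" | c' where "c = Suc (Suc c')" by (metis One_nat_def old.nat.exhaust)
      thus ?thesis unfolding M cheb_F_def if_not_P[OF F]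
        by cases (use 2 k in \<open>auto simp: two mult.assoc t0 numeral_2_eq_2 simp del: mult_pCons_left mult_pCons_right\<close>)
    next
      case 3
      have c0: "c = 0" using c 3 by simp
      have ij3: "i < k * m" "j < 1 * n" using i j 3 by simp_all
      have e3: "\<not> (1 \<le> e \<and> e \<le> k - 2)" "e \<noteq> k - 1" using 3 k by auto
      show ?thesis
      proof (cases r)
        case First
        have "cheb_M r k m n e P $$ (i, j) = [:1/2:] *
            ((if t + 1 = 1 then [:0, 2:] \<cdot>\<^sub>m Q k + Q (k - 1)
              else if k = 2 then 2 \<cdot>\<^sub>m Q 0 - 2 \<cdot>\<^sub>m Q 2
              else if t + 1 = 2 then Q (k - 2) - 2 \<cdot>\<^sub>m Q k
              else if t + 1 = k then 2 \<cdot>\<^sub>m Q 0 - Q 2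
              else Q (k - (t + 1)) - Q (k + 2 - (t + 1))) $$ (i', j'))"
          unfolding cheb_M_def Let_def Qf if_not_P[OF e3(1)] if_not_P[OF e3(2)] First cheb_kind.case
          by (subst index_smult_mat(1))
            (use ij3 in \<open>simp_all only: block_mat_index t_def c_def i'_def j'_def, simp_all add: block_mat_def\<close>)
        also have "\<dots> = smult (1/2)
          (if t = 0 then [:0, 2:] * x k + x (k - 1) else if k = 2 then 2 * x 0 - 2 * x 2
           else if t = 1 then x (k - 2) - 2 * x k else if t = k - 1 then 2 * x 0 - x 2
           else x (k - 1 - t) - x (k + 1 - t))"
          using k t ij' 3 by (simp add: top diff dim Qx del: mult_pCons_left) auto
        finally have M: "cheb_M r k m n e P $$ (i, j) = \<dots>" .
        have F: "r = First \<and> e = 0" using First 3 by simp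
        \<comment> \<open>For \<open>k = 2\<close> the row \<open>t = 1\<close> is also the last one
          and receives both corrections, which gives the separate case in the definition.\<close>
        consider "t = 0" | "t = 1" | "t \<ge> 2" "t = k - 1" | "t \<ge> 2" "t \<noteq> k - 1" by linarith
        thus ?thesis unfolding M cheb_F_def if_P[OF F]
        proof cases
          case 3
          hence "t \<noteq> 0" "t \<noteq> 1" "k \<noteq> 2" "k - 1 - t = 0" "k + 1 - t = 2" using k by simp_all
          thus "smult (1/2) (if t = 0 then [:0, 2:] * x k + x (k - 1) else if k = 2 then 2 * x 0 - 2 * x 2
              else if t = 1 then x (k - 2) - 2 * x k else if t = k - 1 then 2 * x 0 - x 2
              else x (k - 1 - t) - x (k + 1 - t)) =
            smult (1/2) ((if t = 0 then 2 * [:0, 1:] * x k else 0) + 1 * x (k - 1 - t)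
              - (if t = 0 then 0 else 1 * x (k + 1 - t)) - (if t = 1 then 1 * x k else 0)
              + (if t = k - 1 then 1 * x 0 else 0))"
            using 3(2) by (simp only: if_False if_True simp_thms mult_1_left) simp
        qed (use k t \<open>e = 0\<close> in \<open>auto simp: two mult.assoc numeral_2_eq_2 simp del: mult_pCons_left mult_pCons_right\<close>)
      next
        case Second
        have "cheb_M r k m n e P $$ (i, j) =
            (if t + 1 = 1 then [:0, 2:] \<cdot>\<^sub>m Q k + Q (k - 1)
              else if t + 1 = 2 then Q (k - 2) - Q k
              else Q (k - (t + 1))) $$ (i', j')"
          unfolding cheb_M_def Let_def Qf if_not_P[OF e3(1)] if_not_P[OF e3(2)] Second cheb_kind.case
            block_mat_index[OF ij3]
          by (simp only: t_def c_def i'_def j'_def)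
        also have "\<dots> =
          (if t = 0 then [:0, 2:] * x k + x (k - 1) else if t = 1 then x (k - 2) - x k else x (k - 1 - t))"
          using k by (simp add: top diff Qx del: mult_pCons_left)
        finally have M: "cheb_M r k m n e P $$ (i, j) = \<dots>" .
        have F: "\<not> (r = First \<and> e = 0)" using Second by simp
        show ?thesis unfolding M cheb_F_def if_not_P[OF F]
          using k t 3 by (auto simp: two mult.assoc c0 numeral_2_eq_2 simp del: mult_pCons_left mult_pCons_right)
      qed
    qed
  qed
  thus "?L $$ (i, j) = ?R $$ (i, j)"
    using dims i j by (simp add: x_def t_def c_def i'_def j'_def)
qed

text \<open>For constant \<open>x l\<close> each summand is a constant multiple of \<open>a\<close>
  or \<open>b\<close>, so homogenising merely replaces the point.\<close>

lemma hpoly_cheb_F: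
  "hpoly a b (cheb_F 1 [:0, 1:] r k e (\<lambda>l. [:x l:]) t c) = cheb_F a b r k e (\<lambda>l. [:x l:]) t c"
proof -
  have 1: "hpoly a b (1 * [:p:]) = a * [:p:]" "hpoly a b (2 * [:0, 1:] * [:p:]) = 2 * b * [:p:]" for p
    by (simp_all add: hpoly_def numeral_poly)
  have 2: "hpoly a b (p - q) = hpoly a b p - hpoly a b q" for p q
    by (simp add: hpoly_def smult_diff_left)
  show ?thesis
    unfolding cheb_F_def
    by (simp only: hpoly_smult hpoly_add 1 2 hpoly_0 if_distrib[of "hpoly a b"] nat.case_distrib[of "hpoly a b"])
qed

lemma hmat_cheb_M:
  assumes "k \<ge> 2" "e \<le> k - 1" "m > 0" "n > 0" "\<And>i. i \<le> k \<Longrightarrow> P i \<in> carrier_mat m n"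
  shows "hmat a b (cheb_M r k m n e P) =
    mat ((k - e) * m) ((e + 1) * n)
      (\<lambda>(i, j). cheb_F a b r k e (\<lambda>l. [:P l $$ (i mod m, j mod n):]) (i div m) (j div n))"
  by (subst cheb_M_eq) (use assms in \<open>auto simp: hpoly_cheb_F intro!: eq_matI\<close>)

lemma pencil_cheb_M:
  assumes "k \<ge> 2" "e \<le> k - 1" "m > 0" "n > 0" "\<And>i. i \<le> k \<Longrightarrow> P i \<in> carrier_mat m n"
  shows "pencil (cheb_M r k m n e P)"
proof -
  have "hmat 1 [:0, 1:] (cheb_M r k m n e P) = cheb_M r k m n e P"
    by (subst hmat_cheb_M, goal_cases) (use assms cheb_M_eq in auto)
  thus ?thesis by (simp only: pencil_iff_hmat_ident)
qed

section \<open>The double sum that recovers the polynomial\<close>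

lemma sum_lessThan_add:
  fixes p q :: nat
  shows "(\<Sum>t<p + q. f t) = (\<Sum>t<p. f t) + (\<Sum>c<q. f (p + c) :: 'a :: comm_monoid_add)"
  by (induction q) (simp_all add: add.assoc)

lemma sum_atMost_rev: "(\<Sum>l\<le>k. f l) = (\<Sum>t<Suc k. f (k - t) :: 'a :: comm_monoid_add)"
  using sum.nat_diff_reindex[of f "Suc k"] by (simp add: lessThan_Suc_atMost)

text \<open>The coefficient \<open>x k\<close> occurs with \<open>2 * b\<close> in row 0 and with
  \<open>- a\<close> in row 1; by the recurrence these combine to the polynomial of index
  \<open>d\<close>. The other terms are shifted by one. For \<open>d = 1\<close> there is no row 1,
  and the polynomial of index 1 is \<open>2 * b\<close> already.\<close>

lemma sum_cheb_Second_top: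
  fixes a b :: "complex poly" and x :: "nat \<Rightarrow> complex poly"
  assumes "d > 0" "d \<le> k"
  shows "(\<Sum>t<d. a ^ t * hcheb a b Second (d - 1 - t) *
      ((if t = 0 then 2 * b * x k else 0) + a * x (k - 1 - t) - (if t = 1 then a * x k else 0)))
    = (\<Sum>t<Suc d. a ^ t * hcheb a b Second (d - t) * x (k - t))"
proof -
  have "(\<Sum>t<d. a ^ t * hcheb a b Second (d - 1 - t) *
      ((if t = 0 then 2 * b * x k else 0) + a * x (k - 1 - t) - (if t = 1 then a * x k else 0)))
    = (\<Sum>t<d. if t = 0 then hcheb a b Second (d - 1) * (2 * b * x k) else 0)
      + (\<Sum>t<d. a ^ Suc t * hcheb a b Second (d - Suc t) * x (k - Suc t))
      - (\<Sum>t<d. if t = 1 then a * hcheb a b Second (d - 2) * (a * x k) else 0)"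
    unfolding sum.distrib[symmetric] sum_subtractf[symmetric]
    by (intro sum.cong) (auto simp: algebra_simps numeral_2_eq_2)
  also have "(\<Sum>t<d. if t = 0 then hcheb a b Second (d - 1) * (2 * b * x k) else 0)
      = hcheb a b Second (d - 1) * (2 * b * x k)"
    using assms by (simp add: sum.delta)
  also have "(\<Sum>t<d. if t = 1 then a * hcheb a b Second (d - 2) * (a * x k) else 0)
      = (if d \<ge> 2 then a * hcheb a b Second (d - 2) * (a * x k) else 0)"
    by (auto simp: sum.delta)
  also have "hcheb a b Second (d - 1) * (2 * b * x k) + (\<Sum>t<d. a ^ Suc t * hcheb a b Second (d - Suc t) * x (k - Suc t))
      - (if d \<ge> 2 then a * hcheb a b Second (d - 2) * (a * x k) else 0)
    = hcheb a b Second d * x k + (\<Sum>t<d. a ^ Suc t * hcheb a b Second (d - Suc t) * x (k - Suc t))"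
  proof (cases "d \<ge> 2")
    case True
    then obtain q where "d = Suc (Suc q)" by (metis add_2_eq_Suc le_Suc_ex)
    thus ?thesis by (simp add: algebra_simps power2_eq_square)
  next
    case False
    hence "d = 1" using assms by simp
    thus ?thesis by simp
  qed
  also have "\<dots> = (\<Sum>t<Suc d. a ^ t * hcheb a b Second (d - t) * x (k - t))"
    by (subst sum.lessThan_Suc_shift) simp
  finally show ?thesis .
qed

text \<open>Unless \<open>r = First\<close> and \<open>e = 0\<close>, the first two columns give the
  summands with \<open>l \<ge> e\<close>, by the addition theorem, and the last row gives those with
  \<open>l < e\<close>. In the exceptional case the relation between the two kinds takes the place
  of the addition theorem.\<close>

lemma cheb_F_dual_sum:
  fixes a b :: "complex poly"
  assumes k: "k \<ge> 2" and e: "e \<le> k - 1"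
  shows "(\<Sum>t<k - e. \<Sum>c<e + 1. a ^ t * hcheb a b Second (k - 1 - e - t) *
      cheb_F a b r k e x t c * (a ^ c * hcheb a b r (e - c)))
    = (\<Sum>l\<le>k. x l * (a ^ (k - l) * hcheb a b r l))"
proof -
  define U where "U = hcheb a b Second"
  define h where "h = hcheb a b r"
  define d where "d = k - e"
  have d: "d > 0" "k = d + e" "d \<le> k" using k e by (auto simp: d_def)
  have dk: "k - 1 - e - t = d - 1 - t" for t by (simp add: d_def)
  define G where "G = (\<lambda>t. (if t = 0 then 2 * b * x k else 0) + a * x (k - 1 - t) - (if t = 1 then a * x k else 0))"
  have top: "(\<Sum>t<d. a ^ t * U (d - 1 - t) * G t) = (\<Sum>t<Suc d. a ^ t * U (d - t) * x (k - t))"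
    unfolding U_def G_def by (rule sum_cheb_Second_top) (use d in auto)
  show ?thesis
  proof (cases "r = First \<and> e = 0")
    case True
    hence r: "r = First" and e0: "e = 0" and dk': "d = k" using d by auto
    obtain q where q: "k = Suc (Suc q)" using k by (metis add_2_eq_Suc le_Suc_ex)
    have half: "2 * smult (1/2) p = p" for p :: "complex poly" by (simp add: numeral_poly)
    have F: "2 * cheb_F a b r k e x t 0 = G t - (if t = 0 then 0 else a * x (k + 1 - t))
        + (if t = k - 1 then a * x 0 else 0)" for t
      unfolding cheb_F_def if_P[OF True] half G_def by (simp only: algebra_simps)
    \<comment> \<open>Everything is doubled to clear the factor 1/2 of the body.\<close>
    have "2 * (\<Sum>t<d. \<Sum>c<e + 1. a ^ t * U (d - 1 - t) * cheb_F a b r k e x t c * (a ^ c * h (e - c)))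
      = (\<Sum>t<k. a ^ t * U (k - 1 - t) * (2 * cheb_F a b r k e x t 0))"
      by (simp add: e0 dk' h_def sum_distrib_left algebra_simps)
    also have "\<dots> = (\<Sum>t<k. a ^ t * U (k - 1 - t) * G t)
        - (\<Sum>t<k. if t = 0 then 0 else a ^ t * U (k - 1 - t) * (a * x (k + 1 - t)))
        + (\<Sum>t<k. if t = k - 1 then a ^ (k - 1) * (a * x 0) else 0)"
      unfolding sum.distrib[symmetric] sum_subtractf[symmetric]
      by (intro sum.cong) (auto simp: F U_def algebra_simps)
    also have "(\<Sum>t<k. if t = k - 1 then a ^ (k - 1) * (a * x 0) else 0) = a ^ k * x 0"
      by (simp add: q)
    also have "(\<Sum>t<k. if t = 0 then 0 else a ^ t * U (k - 1 - t) * (a * x (k + 1 - t))) =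
        (\<Sum>t<Suc q. a ^ (t + 2) * U (q - t) * x (k - t))"
      unfolding q by (subst sum.lessThan_Suc_shift) (auto simp: algebra_simps power2_eq_square intro!: sum.cong)
    also have "(\<Sum>t<k. a ^ t * U (k - 1 - t) * G t) = (\<Sum>t<Suc k. a ^ t * U (k - t) * x (k - t))"
      using top dk' by simp
    \<comment> \<open>The conversion between the kinds needs index at least 2, so the indices 1 and
      0 are split off. For index 0 the second copy of \<open>a ^ k * x 0\<close> comes from the
      correction in the last row.\<close>
    also have "\<dots> = (\<Sum>t<Suc q. a ^ t * U (k - t) * x (k - t)) + a ^ Suc q * U 1 * x 1 + a ^ k * x 0"
      by (simp add: q U_def)
    also have "(\<Sum>t<Suc q. a ^ t * U (k - t) * x (k - t)) + a ^ Suc q * U 1 * x 1 + a ^ k * x 0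
        - (\<Sum>t<Suc q. a ^ (t + 2) * U (q - t) * x (k - t)) + a ^ k * x 0
      = (\<Sum>t<Suc q. a ^ t * x (k - t) * (U (k - t) - a\<^sup>2 * U (q - t)))
         + 2 * (a ^ Suc q * x 1 * h 1) + 2 * (a ^ k * x 0)"
    proof -
      have "(\<Sum>t<Suc q. a ^ t * U (k - t) * x (k - t)) - (\<Sum>t<Suc q. a ^ (t + 2) * U (q - t) * x (k - t))
        = (\<Sum>t<Suc q. a ^ t * x (k - t) * (U (k - t) - a\<^sup>2 * U (q - t)))"
        unfolding sum_subtractf[symmetric]
        by (intro sum.cong) (simp_all add: algebra_simps power_add power2_eq_square)
      moreover have "a ^ Suc q * U 1 * x 1 = 2 * (a ^ Suc q * x 1 * h 1)"
        by (simp add: U_def h_def r)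
      ultimately show ?thesis by (simp only: algebra_simps mult_2)
    qed
    also have "(\<Sum>t<Suc q. a ^ t * x (k - t) * (U (k - t) - a\<^sup>2 * U (q - t)))
      = 2 * (\<Sum>t<Suc q. a ^ t * x (k - t) * h (k - t))"
      unfolding sum_distrib_left
    proof (rule sum.cong)
      fix t assume "t \<in> {..<Suc q}"
      hence "k - t = Suc (Suc (q - t))" by (auto simp: q)
      thus "a ^ t * x (k - t) * (U (k - t) - a\<^sup>2 * U (q - t)) = 2 * (a ^ t * x (k - t) * h (k - t))"
        using hcheb_First_conv_Second[of a b "q - t"] by (simp only: U_def h_def r) (metis mult.left_commute)
    qed simp
    also have "2 * (\<Sum>t<Suc q. a ^ t * x (k - t) * h (k - t)) + 2 * (a ^ Suc q * x 1 * h 1) + 2 * (a ^ k * x 0)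
      = 2 * (\<Sum>t<Suc k. x (k - t) * (a ^ t * h (k - t)))"
      by (simp add: q h_def algebra_simps)
    also have "(\<Sum>t<Suc k. x (k - t) * (a ^ t * h (k - t))) = (\<Sum>l\<le>k. x l * (a ^ (k - l) * h l))"
      unfolding sum_atMost_rev by (intro sum.cong) auto
    finally have "2 * (\<Sum>t<d. \<Sum>c<e + 1. a ^ t * U (d - 1 - t) * cheb_F a b r k e x t c * (a ^ c * h (e - c)))
       = 2 * (\<Sum>l\<le>k. x l * (a ^ (k - l) * h l))" .
    thus ?thesis unfolding dk U_def h_def d_def by simp
  next
    case False
    \<comment> \<open>The summand of the target for \<open>l = k - t\<close>.\<close>
    define f where "f = (\<lambda>t. a ^ t * x (k - t) * h (k - t))"
    have inner: "(\<Sum>c<e + 1. cheb_F a b r k e x t c * (a ^ c * h (e - c))) =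
        G t * h e - (if e \<ge> 1 then a\<^sup>2 * x (k - t) * h (e - 1) else 0)
        + (if t = d - 1 then \<Sum>c<e. a * x (e - 1 - c) * (a ^ Suc c * h (e - Suc c)) else 0)" for t
    proof -
      have F: "cheb_F a b r k e x t 0 = G t"
        "cheb_F a b r k e x t (Suc c) = (if t = d - 1 then a * x (e - 1 - c) else 0) - (if c = 0 then a * x (k - t) else 0)"
        for c using False by (auto simp: cheb_F_def G_def d_def)
      have "(\<Sum>c<e. cheb_F a b r k e x t (Suc c) * (a ^ Suc c * h (e - Suc c))) =
          (\<Sum>c<e. (if t = d - 1 then a * x (e - 1 - c) * (a ^ Suc c * h (e - Suc c)) else 0))
        - (\<Sum>c<e. if c = 0 then a * x (k - t) * (a * h (e - 1)) else 0)"
        unfolding F sum_subtractf[symmetric] by (intro sum.cong) (auto simp: algebra_simps)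
      also have "(\<Sum>c<e. if c = 0 then a * x (k - t) * (a * h (e - 1)) else 0) =
          (if e \<ge> 1 then a\<^sup>2 * x (k - t) * h (e - 1) else 0)"
        by (auto simp: sum.delta power2_eq_square algebra_simps)
      finally show ?thesis
        unfolding Suc_eq_plus1[symmetric] by (subst sum.lessThan_Suc_shift) (auto simp: F(1))
    qed
    have "(\<Sum>t<d. \<Sum>c<e + 1. a ^ t * U (d - 1 - t) * cheb_F a b r k e x t c * (a ^ c * h (e - c)))
      = (\<Sum>t<d. a ^ t * U (d - 1 - t) * (\<Sum>c<e + 1. cheb_F a b r k e x t c * (a ^ c * h (e - c))))"
      by (simp only: sum_distrib_left mult.assoc)
    also have "\<dots> = (\<Sum>t<d. a ^ t * U (d - 1 - t) * G t) * h e
        - (\<Sum>t<d. a ^ t * U (d - 1 - t) * (if e \<ge> 1 then a\<^sup>2 * x (k - t) * h (e - 1) else 0))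
        + (\<Sum>t<d. if t = d - 1 then a ^ (d - 1) * (\<Sum>c<e. a * x (e - 1 - c) * (a ^ Suc c * h (e - Suc c))) else 0)"
      unfolding inner sum_distrib_right sum.distrib[symmetric] sum_subtractf[symmetric]
      by (intro sum.cong) (auto simp: algebra_simps U_def)
    also have "(\<Sum>t<d. if t = d - 1 then a ^ (d - 1) * (\<Sum>c<e. a * x (e - 1 - c) * (a ^ Suc c * h (e - Suc c))) else 0)
        = (\<Sum>c<e. f (Suc d + c))"
    proof -
      have "a ^ (d - 1) * (\<Sum>c<e. a * x (e - 1 - c) * (a ^ Suc c * h (e - Suc c))) = (\<Sum>c<e. f (Suc d + c))"
        unfolding sum_distrib_left
      proof (rule sum.cong)
        fix c assume "c \<in> {..<e}"
        hence "k - (Suc d + c) = e - Suc c" using d by simp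
        moreover obtain d' where "d = Suc d'" using d by (cases d) auto
        ultimately show "a ^ (d - 1) * (a * x (e - 1 - c) * (a ^ Suc c * h (e - Suc c))) = f (Suc d + c)"
          by (simp add: f_def power_add)
      qed simp
      thus ?thesis using d(1) by simp
    qed
    also have "(\<Sum>t<d. a ^ t * U (d - 1 - t) * G t) * h e
        - (\<Sum>t<d. a ^ t * U (d - 1 - t) * (if e \<ge> 1 then a\<^sup>2 * x (k - t) * h (e - 1) else 0)) = (\<Sum>t<Suc d. f t)"
    proof -
      have "(\<Sum>t<d. a ^ t * U (d - t) * x (k - t)) * h e
        - (\<Sum>t<d. a ^ t * U (d - 1 - t) * (if e \<ge> 1 then a\<^sup>2 * x (k - t) * h (e - 1) else 0)) = (\<Sum>t<d. f t)"
        unfolding sum_distrib_right sum_subtractf[symmetric]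
      proof (rule sum.cong)
        fix t assume "t \<in> {..<d}"
        \<comment> \<open>With \<open>q = e - 1\<close> the index \<open>k - t\<close> is
          \<open>p + q + 2\<close>, the form required by the addition theorem. For
          \<open>e = 0\<close> the kind is \<open>Second\<close>, and both families
          coincide.\<close>
        then obtain p where p: "d - t = Suc p" "d - 1 - t = p" "k - t = Suc p + e" using d
          by (metis Suc_diff_Suc diff_Suc_eq_diff_pred lessThan_iff Nat.add_diff_assoc2 less_imp_le)
        show "a ^ t * U (d - t) * x (k - t) * h e
          - a ^ t * U (d - 1 - t) * (if e \<ge> 1 then a\<^sup>2 * x (k - t) * h (e - 1) else 0) = f t"
        proof (cases e)
          case 0
          hence "r = Second" using False by (cases r) auto
          thus ?thesis using p by (simp add: f_def 0 U_def h_def)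
        next
          case (Suc q)
          have eq: "h (k - t) = U (Suc p) * h e - a\<^sup>2 * U p * h q"
            using hcheb_add[of a b r p q] p by (simp add: Suc U_def h_def del: hcheb.simps)
          show ?thesis unfolding f_def p(1,2) eq by (simp add: Suc algebra_simps)
        qed
      qed simp
      \<comment> \<open>The sum over the first column has one term more than the one over the
        second; it is already the summand for \<open>l = e\<close>.\<close>
      moreover have "a ^ d * U 0 * x (k - d) * h e = f d" using d by (simp add: f_def U_def)
      ultimately show ?thesis unfolding top by (simp add: distrib_right algebra_simps)
    qed
    also have "(\<Sum>t<Suc d. f t) + (\<Sum>c<e. f (Suc d + c)) = (\<Sum>t<Suc k. f t)"
      using sum_lessThan_add[of f "Suc d" e] d by simp
    also have "\<dots> = (\<Sum>l\<le>k. x l * (a ^ (k - l) * h l))"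
      unfolding sum_atMost_rev by (intro sum.cong) (auto simp: f_def)
    finally show ?thesis unfolding dk U_def h_def d_def .
  qed
qed

section \<open>The linearization\<close>

lemma cheb_K_carrier: "cheb_K r e n \<in> carrier_mat (e * n) (e * n + n)"
  by (simp add: cheb_K_def block_mat_def add.commute)

lemma cheb_M_carrier:
  assumes "k \<ge> 2" "e \<le> k - 1" "m > 0" "n > 0" "\<And>i. i \<le> k \<Longrightarrow> P i \<in> carrier_mat m n"
  shows "cheb_M r k m n e P \<in> carrier_mat ((k - e) * m) (e * n + n)"
  by (subst cheb_M_eq) (use assms in \<open>auto simp: add.commute\<close>)

lemma const_mat_carrier [simp]: "const_mat A \<in> carrier_mat p q \<longleftrightarrow> A \<in> carrier_mat p q"
  by (simp add: const_mat_def)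

lemma cheb_N_carrier: "cheb_N a b r e n \<in> carrier_mat (e * n + n) n"
  using kblocks_carrier[of "e + 1" 1 n] by (simp add: cheb_N_def add.commute)

text \<open>Kronecker factors act on block indices only, so entry (i, j) of the product involves
  only the entries (i, j) of the coefficients and reduces to the scalar identity
  \<open>cheb_F_dual_sum\<close>.\<close>

lemma dual_product_cheb_M:
  assumes k: "k \<ge> 2" and e: "e \<le> k - 1" and m: "m > 0" and n: "n > 0"
    and P: "\<And>i. i \<le> k \<Longrightarrow> P i \<in> carrier_mat m n"
  shows "transpose_mat (cheb_N a b Second (k - 1 - e) m) * hmat a b (cheb_M r k m n e P) * cheb_N a b r e n
    = mat m n (\<lambda>(i, j). \<Sum>l\<le>k. smult (P l $$ (i, j)) (a ^ (k - l) * hcheb a b r l))" (is "?N * ?M * _ = ?R")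
proof (rule eq_matI)
  have ke: "k - 1 - e + 1 = k - e" using k e by simp
  have N: "?N = kblocks 1 (k - e) m (\<lambda>_ t. a ^ t * hcheb a b Second (k - 1 - e - t))"
    unfolding cheb_N_def transpose_kblocks ke ..
  have N': "?N \<in> carrier_mat m ((k - e) * m)" using kblocks_carrier[of 1 "k - e" m] unfolding N by simp
  have M: "?M = mat ((k - e) * m) ((e + 1) * n)
      (\<lambda>(i, j). cheb_F a b r k e (\<lambda>l. [:P l $$ (i mod m, j mod n):]) (i div m) (j div n))"
    by (rule hmat_cheb_M) (use assms in auto)
  have M': "?M \<in> carrier_mat ((k - e) * m) ((e + 1) * n)" unfolding M by simp
  show "dim_row (?N * ?M * cheb_N a b r e n) = dim_row ?R" "dim_col (?N * ?M * cheb_N a b r e n) = dim_col ?R"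
    using N' cheb_N_carrier[of a b r e n] by auto
  fix i j assume "i < dim_row ?R" "j < dim_col ?R"
  hence ij: "i < m" "j < n" by auto
  define x where "x = (\<lambda>l. [:P l $$ (i, j):])"
  have NM: "?N * ?M \<in> carrier_mat m ((e + 1) * n)" using N' M' by simp
  have "(?N * ?M * cheb_N a b r e n) $$ (i, j) =
      (\<Sum>c<e + 1. (?N * ?M) $$ (i, c * n + j) * (a ^ c * hcheb a b r (e - c)))"
    unfolding cheb_N_def[of a b r e n] using mult_kblocks_index[OF NM ij(1), of j 1] ij by simp
  also have "\<dots> = (\<Sum>c<e + 1. (\<Sum>t<k - e. a ^ t * hcheb a b Second (k - 1 - e - t) * cheb_F a b r k e x t c) *
      (a ^ c * hcheb a b r (e - c)))"
  proof (rule sum.cong)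
    fix c assume c: "c \<in> {..<e + 1}"
    have cj: "c * n + j < (e + 1) * n" using c ij by (intro block_index_less) auto
    have "(?N * ?M) $$ (i, c * n + j) =
        (\<Sum>t<k - e. a ^ t * hcheb a b Second (k - 1 - e - t) * ?M $$ (t * m + i, c * n + j))"
      unfolding N using kblocks_mult_index[OF M', of i 1 "c * n + j"] cj ij by simp
    also have "\<dots> = (\<Sum>t<k - e. a ^ t * hcheb a b Second (k - 1 - e - t) * cheb_F a b r k e x t c)"
    proof (rule sum.cong)
      fix t assume "t \<in> {..<k - e}"
      hence ti: "t * m + i < (k - e) * m" using ij by (intro block_index_less) auto
      show "a ^ t * hcheb a b Second (k - 1 - e - t) * ?M $$ (t * m + i, c * n + j) =
          a ^ t * hcheb a b Second (k - 1 - e - t) * cheb_F a b r k e x t c"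
        unfolding M using ti cj ij by (simp add: x_def del: mult_Suc)
    qed simp
    finally show "(?N * ?M) $$ (i, c * n + j) * (a ^ c * hcheb a b r (e - c)) =
      (\<Sum>t<k - e. a ^ t * hcheb a b Second (k - 1 - e - t) * cheb_F a b r k e x t c) *
      (a ^ c * hcheb a b r (e - c))" by simp
  qed simp
  also have "\<dots> = (\<Sum>t<k - e. \<Sum>c<e + 1. a ^ t * hcheb a b Second (k - 1 - e - t) *
      cheb_F a b r k e x t c * (a ^ c * hcheb a b r (e - c)))"
    unfolding sum_distrib_right by (rule sum.swap)
  also have "\<dots> = (\<Sum>l\<le>k. x l * (a ^ (k - l) * hcheb a b r l))"
    by (rule cheb_F_dual_sum[OF k e])
  also have "\<dots> = ?R $$ (i, j)" using ij by (simp add: x_def)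
  finally show "(?N * ?M * cheb_N a b r e n) $$ (i, j) = ?R $$ (i, j)" .
qed

section \<open>The pencil and its two evaluations\<close>

text \<open>The kind \<open>r\<close> is a parameter, so that (a) and (b) are proved together; only
  the body and K_1 depend on it.\<close>

definition cheb_pencil ::
    "cheb_kind \<Rightarrow> nat \<Rightarrow> nat \<Rightarrow> nat \<Rightarrow> nat \<Rightarrow> (nat \<Rightarrow> complex mat) \<Rightarrow> complex mat \<Rightarrow> complex mat \<Rightarrow> complex poly mat"
  where
  "cheb_pencil r k m n e P A B =
     four_block_mat
       (cheb_M r k m n e P + const_mat A * cheb_K r e n
         + transpose_mat (cheb_K Second (k - 1 - e) m) * const_mat B)
       (transpose_mat (cheb_K Second (k - 1 - e) m))
       (cheb_K r e n)
       (0\<^sub>m (e * n) ((k - 1 - e) * m))"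

lemma hmat_cheb_pencil:
  assumes k: "k \<ge> 2" and e: "e \<le> k - 1" and m: "m > 0" and n: "n > 0"
    and P: "\<And>i. i \<le> k \<Longrightarrow> P i \<in> carrier_mat m n"
    and A: "A \<in> carrier_mat ((k - e) * m) (e * n)"
    and B: "B \<in> carrier_mat ((k - 1 - e) * m) ((e + 1) * n)"
  shows "hmat a b (cheb_pencil r k m n e P A B) =
     four_block_mat
       (hmat a b (cheb_M r k m n e P) + const_mat A * hmat a b (cheb_K r e n)
         + transpose_mat (hmat a b (cheb_K Second (k - 1 - e) m)) * const_mat B)
       (transpose_mat (hmat a b (cheb_K Second (k - 1 - e) m)))
       (hmat a b (cheb_K r e n))
       (0\<^sub>m (e * n) ((k - 1 - e) * m))"
proof -
  let ?M = "cheb_M r k m n e P" and ?K = "cheb_K r e n" and ?R = "transpose_mat (cheb_K Second (k - 1 - e) m)"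
  have ke: "(k - 1 - e) * m + m = (k - e) * m" using k e by (cases "k - e") auto
  have K: "?K \<in> carrier_mat (e * n) (e * n + n)" by (rule cheb_K_carrier)
  have R: "?R \<in> carrier_mat ((k - e) * m) ((k - 1 - e) * m)"
    using cheb_K_carrier[of Second "k - 1 - e" m] unfolding ke by simp
  have M: "?M \<in> carrier_mat ((k - e) * m) (e * n + n)"
    by (rule cheb_M_carrier) (use assms in auto)
  have B': "B \<in> carrier_mat ((k - 1 - e) * m) (e * n + n)" using B by (simp add: add.commute)
  have AK: "const_mat A * ?K \<in> carrier_mat ((k - e) * m) (e * n + n)"
    by (rule mult_carrier_mat[OF _ K]) (simp only: const_mat_carrier A)
  have RB: "?R * const_mat B \<in> carrier_mat ((k - e) * m) (e * n + n)"
    by (rule mult_carrier_mat[OF R]) (simp only: const_mat_carrier B')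
  show ?thesis
    unfolding cheb_pencil_def
      map_four_block_mat[OF add_carrier_mat[OF RB] R K zero_carrier_mat]
      hmat_add[OF add_carrier_mat[OF AK] RB] hmat_add[OF M AK] hmat_const_mult[OF A K]
      hmat_mult_const[OF B' R] hmat_transpose hmat_zero ..
qed

lemma pencil_cheb_pencil:
  assumes k: "k \<ge> 2" and e: "e \<le> k - 1" and m: "m > 0" and n: "n > 0"
    and P: "\<And>i. i \<le> k \<Longrightarrow> P i \<in> carrier_mat m n"
    and A: "A \<in> carrier_mat ((k - e) * m) (e * n)"
    and B: "B \<in> carrier_mat ((k - 1 - e) * m) ((e + 1) * n)"
  shows "pencil (cheb_pencil r k m n e P A B)"
proof -
  have "pencil (cheb_M r k m n e P)" by (rule pencil_cheb_M) (use assms in auto)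
  hence "hmat 1 [:0, 1:] (cheb_M r k m n e P) = cheb_M r k m n e P"
    by (simp only: pencil_iff_hmat_ident)
  moreover have "hmat 1 [:0, 1:] (cheb_K r e n) = cheb_K r e n" for r e n
    using pencil_cheb_K[of r e n] by (simp only: pencil_iff_hmat_ident)
  moreover note hmat_cheb_pencil[OF k e m n _ A B, of P 1 "[:0, 1:]" r]
  ultimately have "hmat 1 [:0, 1:] (cheb_pencil r k m n e P A B) = cheb_pencil r k m n e P A B"
    using P by (simp add: cheb_pencil_def)
  thus ?thesis by (simp only: pencil_iff_hmat_ident)
qed

text \<open>The block reduction leaves the product of the upper left block with the two null
  columns. These annihilate the terms with \<open>A\<close> and \<open>B\<close>, and the body alone
  yields the polynomial.\<close>

lemma linearization_hmat_cheb_pencil: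
  assumes ab: "hom_point a b"
    and k: "k \<ge> 2" and e: "e \<le> k - 1" and m: "m > 0" and n: "n > 0"
    and P: "\<And>i. i \<le> k \<Longrightarrow> P i \<in> carrier_mat m n"
    and A: "A \<in> carrier_mat ((k - e) * m) (e * n)"
    and B: "B \<in> carrier_mat ((k - 1 - e) * m) ((e + 1) * n)"
    and pencil: "pencil (hmat a b (cheb_pencil r k m n e P A B))"
  shows "linearization (hmat a b (cheb_pencil r k m n e P A B))
    (mat m n (\<lambda>(i, j). \<Sum>l\<le>k. smult (P l $$ (i, j)) (a ^ (k - l) * hcheb a b r l)))"
proof -
  let ?p = "e * n" and ?q = "(k - 1 - e) * m"
  define M where "M = hmat a b (cheb_M r k m n e P)"
  define K where "K = hmat a b (cheb_K r e n)"
  define K' where "K' = hmat a b (cheb_K Second (k - 1 - e) m)"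
  define N where "N = cheb_N a b r e n"
  define N' where "N' = cheb_N a b Second (k - 1 - e) m"
  define D where "D = M + const_mat A * K + transpose_mat K' * const_mat B"
  have ke: "(k - e) * m = ?q + m" using k e by (cases "k - e") auto
  have K: "K \<in> carrier_mat ?p (?p + n)" and K': "K' \<in> carrier_mat ?q (?q + m)"
    unfolding K_def K'_def using cheb_K_carrier by simp_all
  have M: "M \<in> carrier_mat (?q + m) (?p + n)"
    unfolding M_def ke[symmetric] using cheb_M_carrier[OF k e m n, of P r] P by simp
  have N: "N \<in> carrier_mat (?p + n) n" and N': "N' \<in> carrier_mat (?q + m) m"
    unfolding N_def N'_def by (rule cheb_N_carrier)+
  have A': "const_mat A \<in> carrier_mat (?q + m) ?p" using A by (simp add: ke)
  have B': "const_mat B \<in> carrier_mat ?q (?p + n)" using B by (simp add: add.commute)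
  obtain Y H where Y: "Y \<in> carrier_mat (?p + n) ?p" and H: "H \<in> carrier_mat n (?p + n)"
    and KY: "K * Y = 1\<^sub>m ?p" and HY: "H * Y = 0\<^sub>m n ?p" and HN: "H * N = 1\<^sub>m n"
    using ex_dual_hmat_cheb_K[OF ab n, of e r] unfolding K_def N_def by metis
  obtain Y' H' where Y': "Y' \<in> carrier_mat (?q + m) ?q" and H': "H' \<in> carrier_mat m (?q + m)"
    and K'Y': "K' * Y' = 1\<^sub>m ?q" and H'Y': "H' * Y' = 0\<^sub>m m ?q" and H'N': "H' * N' = 1\<^sub>m m"
    and YK: "Y' * K' + N' * H' = 1\<^sub>m (?q + m)"
    using ex_dual_hmat_cheb_K[OF ab m, of "k - 1 - e" Second] unfolding K'_def N'_def by metis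
  have KN: "K * N = 0\<^sub>m ?p n" unfolding K_def N_def by (rule hmat_cheb_K_mult_N)
  have K'N': "K' * N' = 0\<^sub>m ?q m" unfolding K'_def N'_def by (rule hmat_cheb_K_mult_N)
  \<comment> \<open>K_2 enters the pencil through its transpose, so its completion is transposed
    too: \<open>Y'\<close> and \<open>N'\<close> supply the dual rows, \<open>H'\<close> the
    complement of the columns.\<close>
  note tr = transpose_mult[symmetric]
  have AR: "transpose_mat Y' * transpose_mat K' = 1\<^sub>m ?q" by (simp add: tr[OF K' Y'] K'Y')
  have AG: "transpose_mat Y' * transpose_mat H' = 0\<^sub>m ?q m" by (simp add: tr[OF H' Y'] H'Y')
  have BR: "transpose_mat N' * transpose_mat K' = 0\<^sub>m m ?q" by (simp add: tr[OF K' N'] K'N')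
  have BG: "transpose_mat N' * transpose_mat H' = 1\<^sub>m m" by (simp add: tr[OF H' N'] H'N')
  have "transpose_mat (Y' * K' + N' * H') = transpose_mat K' * transpose_mat Y' + transpose_mat H' * transpose_mat N'"
    using Y' K' N' H'
    by (simp add: transpose_add[OF mult_carrier_mat[OF Y' K'] mult_carrier_mat[OF N' H']]
        transpose_mult[OF Y' K'] transpose_mult[OF N' H'])
  hence RA: "transpose_mat K' * transpose_mat Y' + transpose_mat H' * transpose_mat N' = 1\<^sub>m (?q + m)"
    unfolding YK by simp
  have tcarr: "transpose_mat K' \<in> carrier_mat (?q + m) ?q" "transpose_mat N' \<in> carrier_mat m (?q + m)"
    "transpose_mat Y' \<in> carrier_mat ?q (?q + m)" "transpose_mat H' \<in> carrier_mat (?q + m) m"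
    using K' N' Y' H' by simp_all
  have AK: "const_mat A * K \<in> carrier_mat (?q + m) (?p + n)" by (rule mult_carrier_mat[OF A' K])
  have RB: "transpose_mat K' * const_mat B \<in> carrier_mat (?q + m) (?p + n)"
    by (rule mult_carrier_mat[OF tcarr(1) B'])
  have D: "D \<in> carrier_mat (?q + m) (?p + n)" unfolding D_def by (rule add_carrier_mat[OF RB])
  have L: "hmat a b (cheb_pencil r k m n e P A B) = four_block_mat D (transpose_mat K') K (0\<^sub>m ?p ?q)"
    unfolding D_def M_def K_def K'_def by (rule hmat_cheb_pencil) (use assms in auto)
  \<comment> \<open>As \<open>k \<ge> 2\<close>, at least one of K_1 and K_2 has rows, so the
    identity block has positive size.\<close>
  have "(e = 0 \<longrightarrow> k - 1 - e > 0)" using k by simp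
  hence "?p + ?q > 0" using m n by auto
  from linearization_block[OF D tcarr(3) tcarr(2) tcarr(1) tcarr(4) K H Y N AR AG BR BG RA KY KN HY HN this]
  have "linearization (hmat a b (cheb_pencil r k m n e P A B)) (transpose_mat N' * D * N)"
    using pencil unfolding L by blast
  also have "transpose_mat N' * D * N = transpose_mat N' * M * N"
  proof -
    have NK: "transpose_mat N' * (transpose_mat K' * const_mat B) = 0\<^sub>m m (?p + n)"
      unfolding assoc_mult_mat[OF tcarr(2) tcarr(1) B', symmetric] BR by (rule left_mult_zero_mat[OF B'])
    have AKN: "transpose_mat N' * (const_mat A * K) * N = 0\<^sub>m m n"
    proof -
      have "transpose_mat N' * (const_mat A * K) * N = transpose_mat N' * (const_mat A * (K * N))"
        unfolding assoc_mult_mat[OF tcarr(2) AK N] assoc_mult_mat[OF A' K N] ..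
      also have "const_mat A * (K * N) = 0\<^sub>m (?q + m) n" unfolding KN by (rule right_mult_zero_mat[OF A'])
      finally show ?thesis using right_mult_zero_mat[OF tcarr(2)] by simp
    qed
    have NM: "transpose_mat N' * M \<in> carrier_mat m (?p + n)" by (rule mult_carrier_mat[OF tcarr(2) M])
    have NAK: "transpose_mat N' * (const_mat A * K) \<in> carrier_mat m (?p + n)"
      by (rule mult_carrier_mat[OF tcarr(2) AK])
    have "transpose_mat N' * D = transpose_mat N' * M + transpose_mat N' * (const_mat A * K)"
      unfolding D_def mult_add_distrib_mat[OF tcarr(2) add_carrier_mat[OF AK] RB]
        mult_add_distrib_mat[OF tcarr(2) M AK] NK
      by (rule right_add_zero_mat[OF add_carrier_mat[OF NAK]])
    hence "transpose_mat N' * D * N = transpose_mat N' * M * N + 0\<^sub>m m n"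
      by (simp only: add_mult_distrib_mat[OF NM NAK N] AKN)
    thus ?thesis using right_add_zero_mat[OF mult_carrier_mat[OF NM N]] by simp
  qed
  also have "transpose_mat N' * M * N =
      mat m n (\<lambda>(i, j). \<Sum>l\<le>k. smult (P l $$ (i, j)) (a ^ (k - l) * hcheb a b r l))"
    unfolding N'_def M_def N_def by (rule dual_product_cheb_M) (use assms in auto)
  finally show ?thesis .
qed

text \<open>The point (1, \<lambda>) gives the pencil with its polynomial, and (\<lambda>, 1) gives
  both reversals: reversing \<phi>_l at grade \<open>k\<close> produces the factor
  \<open>a ^ (k - l)\<close> that the homogenised product carries.\<close>

lemma strong_linearization_cheb_pencil:
  assumes k: "k \<ge> 2" and e: "e \<le> k - 1" and m: "m > 0" and n: "n > 0"
    and P: "\<And>i. i \<le> k \<Longrightarrow> P i \<in> carrier_mat m n"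
    and A: "A \<in> carrier_mat ((k - e) * m) (e * n)"
    and B: "B \<in> carrier_mat ((k - 1 - e) * m) ((e + 1) * n)"
  shows "strong_linearization k (cheb_pencil r k m n e P A B) (cheb_mat_poly r k m n P)"
proof -
  let ?L = "cheb_pencil r k m n e P A B"
  have pL: "pencil ?L" by (rule pencil_cheb_pencil) (use assms in auto)
  hence L1: "hmat 1 [:0, 1:] ?L = ?L" by (simp only: pencil_iff_hmat_ident)
  have "degree (smult c (cheb r l)) \<le> k" if "l \<le> k" for c l
    using degree_cheb[of r l] degree_smult_le[of c "cheb r l"] that by linarith
  hence grade: "has_grade k (cheb_mat_poly r k m n P)"
    by (auto simp: has_grade_def cheb_mat_poly_def intro!: degree_sum_le)
  have "linearization (hmat 1 [:0, 1:] ?L)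
      (mat m n (\<lambda>(i, j). \<Sum>l\<le>k. smult (P l $$ (i, j)) (1 ^ (k - l) * hcheb 1 [:0, 1:] r l)))"
    by (rule linearization_hmat_cheb_pencil) (use assms pL L1 in \<open>auto simp: hom_point_def\<close>)
  hence lin: "linearization ?L (cheb_mat_poly r k m n P)"
    by (simp add: L1 cheb_mat_poly_def cheb_eq_hcheb)
  have "linearization (hmat [:0, 1:] 1 ?L)
      (mat m n (\<lambda>(i, j). \<Sum>l\<le>k. smult (P l $$ (i, j)) ([:0, 1:] ^ (k - l) * hcheb [:0, 1:] 1 r l)))"
    by (rule linearization_hmat_cheb_pencil)
      (use assms pencil_rev_mat in \<open>auto simp: hom_point_def hmat_eq_rev_mat\<close>)
  also have "mat m n (\<lambda>(i, j). \<Sum>l\<le>k. smult (P l $$ (i, j)) ([:0, 1:] ^ (k - l) * hcheb [:0, 1:] 1 r l)) =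
      rev_mat k (cheb_mat_poly r k m n P)"
    by (intro eq_matI) (auto simp: rev_mat_def cheb_mat_poly_def rev_poly_sum rev_poly_smult rev_poly_cheb)
  finally have "linearization (rev_mat 1 ?L) (rev_mat k (cheb_mat_poly r k m n P))"
    by (simp only: hmat_eq_rev_mat)
  thus ?thesis using grade lin by (simp add: strong_linearization_def)
qed

theorem theorem5p7:
  fixes k m n \<epsilon> :: nat
    and P :: "nat \<Rightarrow> complex mat"
    and A B :: "complex mat"
  assumes "k \<ge> 2" and "m \<ge> 1" and "n \<ge> 1" and "\<epsilon> \<le> k - 1"
    and "\<And>i. i \<le> k \<Longrightarrow> P i \<in> carrier_mat m n"
    and "A \<in> carrier_mat ((k - \<epsilon>) * m) (\<epsilon> * n)"
    and "B \<in> carrier_mat ((k - 1 - \<epsilon>) * m) ((\<epsilon> + 1) * n)"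
  shows
    "strong_linearization k
       (four_block_mat
         (cheb_M First k m n \<epsilon> P
            + const_mat A * cheb_K First \<epsilon> n
            + transpose_mat (cheb_K Second (k - 1 - \<epsilon>) m) * const_mat B)
         (transpose_mat (cheb_K Second (k - 1 - \<epsilon>) m))
         (cheb_K First \<epsilon> n)
         (0\<^sub>m (\<epsilon> * n) ((k - 1 - \<epsilon>) * m)))
       (cheb_mat_poly First k m n P)
     \<and>
     strong_linearization k
       (four_block_mat
         (cheb_M Second k m n \<epsilon> P
            + const_mat A * cheb_K Second \<epsilon> n
            + transpose_mat (cheb_K Second (k - 1 - \<epsilon>) m) * const_mat B)
         (transpose_mat (cheb_K Second (k - 1 - \<epsilon>) m))
         (cheb_K Second \<epsilon> n)
         (0\<^sub>m (\<epsilon> * n) ((k - 1 - \<epsilon>) * m)))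
       (cheb_mat_poly Second k m n P)"
proof -
  have "strong_linearization k (cheb_pencil r k m n \<epsilon> P A B) (cheb_mat_poly r k m n P)" for r
    by (rule strong_linearization_cheb_pencil) (use assms in auto)
  thus ?thesis unfolding cheb_pencil_def by blast
qed

end
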